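(* Let $G=(\mathcal{V},\mathcal{E})$ be a finite simple graph with $l=|\mathcal{V}|$ vertices, and let $\mathcal{P}\subset\mathcal{V}$ be a set of $m$ pinned vertices such that no edge of $\mathcal{E}$ joins two vertices of $\mathcal{P}$. Let $\alpha\in(0,d)$, let $1\le p\le\infty$, and let $\Phi=(\Phi_{e})_{e\in\mathcal{E}}$ be a continuous edge vector function of $G$ which is $\alpha$-suitable for the stars in $(G,\mathcal{P})$ in the $L^p$ sense. Then for every compact set $E\subset\mathbb{R}^d$ with $\dim(E)>\alpha$ there exist $x_1,\dots,x_m\in E$ such that $\Delta^{G,\Phi}_{\mathcal{P},x_1,\dots,x_m}(E)$ has positive $|\mathcal{E}|$-dimensional Lebesgue measure.
   Context: An edge vector function for $G$ is a continuous map $\Phi=(\Phi_e)_{e\in\mathcal{E}}:\mathbb{R}^{d l}\to\mathbb{R}^{|\mathcal{E}|}$ where, for an edge $e=(v_i,v_j)$, the component $\Phi_e$ depends only on the coordinates $x_i,x_j$, via a symmetric function $\Phi_{(v_i,v_j)}(a,b)=\Phi_{(v_i,v_j)}(b,a)$, $a,b\in\mathbb{R}^d$. With vertices ordered $v_1,\dots,v_l$ so that $v_1,\dots,v_m$ are the pins, and distinct $x_1,\dots,x_m$, set $\Delta^{G,\Phi}_{\mathcal{P},x_1,\dots,x_m}(E)=\{\Phi(x_1,\dots,x_m,y_{m+1},\dots,y_l): y_{m+1},\dots,y_l\in E\text{ distinct}\}$. A construction order is an ordering $v_1,\dots,v_l$ of $\mathcal{V}$ whose first $m$ entries are the pinned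 vertices. For such an order and $r>m$, let $\eta_r$ be the set of indices $i<r$ with $v_i$ adjacent to $v_r$, and $\epsilon_r=|\eta_r|$. For points $(x_i)_{i\in\eta_r}$ define $d^{\epsilon_r\text{-star},\Phi^r}_{(x_i)_{i\in\eta_r}}(y)=(\Phi_{(v_i,v_r)}(x_i,y))_{i\in\eta_r}\in\mathbb{R}^{\epsilon_r}$. $\Phi$ is $\alpha$-suitable for the stars in $(G,\mathcal{P})$ in the $L^p$ sense if there is a construction order such that for every $m+1\le r\le l$ the following holds: for every compact $E$ with $\dim(E)>\alpha$, every $s$-Frostman measure $\mu$ on $E$ with $s>\alpha$, and pairwise separated compact subsets $E_i$ ($i\in\eta_r$) and $E_r$ of $E$ with positive $\mu$-measure, for $\prod_{i\in\eta_r}\mu_{E_i}$-almost every $(x_i)_{i\in\eta_r}\in\prod_{i\in\eta_r}E_i$ the pushforward measure $(d^{\epsilon_r\text{-star},\Phi^r}_{(x_i)_{i\in\eta_r}})_*(\mu_{E_r})$ is absolutely continuous with respect to Lebesgue measure on $\mathbb{R}^{\epsilon_r}$ with density in $L^p(\mathbb{R}^{\epsilon_r})$. An $s$-Frostman measure on compact $E$ is a finite nonzero Borel measure supported on $E$ with $\mu(B(x,r))\le Cr^s$ for all $x$, $r>0$; $\mu_F(A)=\mu(A\cap F)$. Pairwise separated means pairwise at positive distance. *)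

theory Defs
  imports "HOL-Analysis.Analysis"
begin

text \<open>s-dimensional Hausdorff content: infimum over countable covers by bounded sets
  of the sum of diam(C i)^s.  Its null sets coincide with those of the s-dimensional
  Hausdorff measure, so the dimension below is the usual Hausdorff dimension.\<close>
definition hausdorff_content :: "real \<Rightarrow> 'a::metric_space set \<Rightarrow> ennreal" where
  "hausdorff_content s A =
     (INF C \<in> {C :: nat \<Rightarrow> 'a set. (\<forall>i. bounded (C i)) \<and> A \<subseteq> (\<Union>i. C i)}.
        (\<Sum>i. ennreal (diameter (C i) powr s)))"

definition hausdorff_dim :: "'a::metric_space set \<Rightarrow> real" where
  "hausdorff_dim A = Inf {s::real. s > 0 \<and> hausdorff_content s A = 0}"

definition frostman :: "real \<Rightarrow> 'a::euclidean_space set \<Rightarrow> 'a measure \<Rightarrow> bool" where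
  "frostman s E \<mu> \<longleftrightarrow>
     sets \<mu> = sets borel \<and> emeasure \<mu> (space \<mu>) < \<infinity> \<and> emeasure \<mu> (space \<mu>) \<noteq> 0 \<and>
     emeasure \<mu> (UNIV - E) = 0 \<and>
     (\<exists>C. \<forall>x r. r > 0 \<longrightarrow> emeasure \<mu> (ball x r) \<le> ennreal (C * r powr s))"

definition restr_measure :: "'a measure \<Rightarrow> 'a set \<Rightarrow> 'a measure" where
  "restr_measure \<mu> F = density \<mu> (indicator F)"

definition Lp_density :: "'b measure \<Rightarrow> ereal \<Rightarrow> 'b measure \<Rightarrow> bool" where
  "Lp_density M p N \<longleftrightarrow>
     (\<exists>f::'b \<Rightarrow> real. f \<in> borel_measurable M \<and> (\<forall>z. f z \<ge> 0) \<and>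
        N = density M (\<lambda>z. ennreal (f z)) \<and>
        (if p = \<infinity> then (\<exists>C. AE z in M. f z \<le> C)
         else integrable M (\<lambda>z. f z powr real_of_ereal p)))"

definition simple_graph :: "'v set \<Rightarrow> 'v set set \<Rightarrow> bool" where
  "simple_graph V Ed \<longleftrightarrow> finite V \<and> (\<forall>e\<in>Ed. \<exists>u w. u \<in> V \<and> w \<in> V \<and> u \<noteq> w \<and> e = {u, w})"

definition edge_vector_function :: "'v set set \<Rightarrow> ('v set \<Rightarrow> 'a::euclidean_space \<Rightarrow> 'a \<Rightarrow> real) \<Rightarrow> bool" where
  "edge_vector_function Ed \<Phi> \<longleftrightarrow>
     (\<forall>e\<in>Ed. continuous_on UNIV (\<lambda>(a,b). \<Phi> e a b) \<and> (\<forall>a b. \<Phi> e a b = \<Phi> e b a))"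

definition end1 :: "'v set \<Rightarrow> 'v" where "end1 e = (SOME u. u \<in> e)"
definition end2 :: "'v set \<Rightarrow> 'v" where "end2 e = (SOME w. w \<in> e \<and> w \<noteq> end1 e)"

definition Phi_eval :: "'v set set \<Rightarrow> ('v set \<Rightarrow> 'a \<Rightarrow> 'a \<Rightarrow> real) \<Rightarrow> ('v \<Rightarrow> 'a) \<Rightarrow> ('v set \<Rightarrow> real)" where
  "Phi_eval Ed \<Phi> y = (\<lambda>e\<in>Ed. \<Phi> e (y (end1 e)) (y (end2 e)))"

definition pinned_config_set ::
  "'v set \<Rightarrow> 'v set set \<Rightarrow> 'v set \<Rightarrow> ('v set \<Rightarrow> 'a \<Rightarrow> 'a \<Rightarrow> real) \<Rightarrow> ('v \<Rightarrow> 'a) \<Rightarrow> 'a set \<Rightarrow> ('v set \<Rightarrow> real) set" where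
  "pinned_config_set V Ed P \<Phi> x E =
     {Phi_eval Ed \<Phi> y | y. (\<forall>v\<in>P. y v = x v) \<and> (\<forall>v\<in>V - P. y v \<in> E) \<and> inj_on y (V - P)}"

definition construction_order :: "'v set \<Rightarrow> 'v set \<Rightarrow> 'v list \<Rightarrow> bool" where
  "construction_order V P vs \<longleftrightarrow> distinct vs \<and> set vs = V \<and> set (take (card P) vs) = P"

definition eta :: "'v set set \<Rightarrow> 'v list \<Rightarrow> nat \<Rightarrow> nat set" where
  "eta Ed vs r = {i. i < r \<and> {vs ! i, vs ! r} \<in> Ed}"

definition star_map :: "'v set set \<Rightarrow> ('v set \<Rightarrow> 'a \<Rightarrow> 'a \<Rightarrow> real) \<Rightarrow> 'v list \<Rightarrow> nat \<Rightarrow> (nat \<Rightarrow> 'a) \<Rightarrow> 'a \<Rightarrow> (nat \<Rightarrow> real)" where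
  "star_map Ed \<Phi> vs r xs y = (\<lambda>i\<in>eta Ed vs r. \<Phi> {vs ! i, vs ! r} (xs i) y)"

definition alpha_suitable_stars ::
  "real \<Rightarrow> ereal \<Rightarrow> 'v set \<Rightarrow> 'v set set \<Rightarrow> 'v set \<Rightarrow> ('v set \<Rightarrow> 'a::euclidean_space \<Rightarrow> 'a \<Rightarrow> real) \<Rightarrow> bool" where
  "alpha_suitable_stars \<alpha> p V Ed P \<Phi> \<longleftrightarrow>
     (\<exists>vs. construction_order V P vs \<and>
       (\<forall>r. card P \<le> r \<and> r < card V \<longrightarrow>
         (\<forall>(E::'a set) s \<mu> (Es :: nat \<Rightarrow> 'a set).
            compact E \<and> hausdorff_dim E > \<alpha> \<and> s > \<alpha> \<and> frostman s E \<mu> \<and>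
            (\<forall>i\<in>insert r (eta Ed vs r). compact (Es i) \<and> Es i \<subseteq> E \<and> emeasure \<mu> (Es i) > 0) \<and>
            (\<forall>i\<in>insert r (eta Ed vs r). \<forall>j\<in>insert r (eta Ed vs r). i \<noteq> j \<longrightarrow>
               (\<exists>\<delta>>0. \<forall>a\<in>Es i. \<forall>b\<in>Es j. dist a b \<ge> \<delta>))
            \<longrightarrow>
            (AE xs in Pi\<^sub>M (eta Ed vs r) (\<lambda>i. restr_measure \<mu> (Es i)).
               Lp_density (Pi\<^sub>M (eta Ed vs r) (\<lambda>_. lborel)) p
                 (distr (restr_measure \<mu> (Es r)) (Pi\<^sub>M (eta Ed vs r) (\<lambda>_. lborel))
                    (star_map Ed \<Phi> vs r xs))))))"

end

theory Submission
  imports Defs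
begin

text \<open>Frostman's lemma supplies an s-Frostman measure on E with s > \<alpha>; it has no atoms, so there are
  separated compact pieces of E of positive measure, one for each vertex. Reveal the vertices in
  reverse construction order: by backward induction on r, for almost every choice of the first r
  points the set of values of the edges with an endpoint among the remaining vertices has positive
  measure. In the step from r + 1 to r, the fibre of this set over the star value of a point y
  at the r-th vertex contains the set obtained after revealing y, which has positive measure for
  almost every y. If the whole set were null, almost every fibre would be null, and by absolute
  continuity of the pushforward under the star map so would be the fibres over the star values of
  almost every y.\<close>

subsection \<open>Frostman's lemma\<close>

text \<open>Frostman's lemma is proved with the content instead of the Hausdorff measure. Below the
  dimension both are nonzero, but the measure may be infinite, whereas the content of a bounded set
  is finite and so can serve as a mass to be distributed over cells. The obstacle in the second half
  is measurability of sets of edge values, which are images under a continuous map. Compactness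
  resolves it: each vertex ranges over its own compact piece, so the value sets are compact. Since
  the pieces are disjoint, distinctness of the points holds by itself and need not be imposed as a
  condition that is not closed. The full pinned set, where distinctness is imposed, is a countable
  union of compact images. Suitability says nothing about an individual star, only about almost
  every one. The pins therefore stay variable throughout the induction and are fixed at the very
  end, from a product of pieces of positive measure.\<close>

lemma hausdorff_content_le_diameter:
  assumes "bounded A"
  shows "hausdorff_content s A \<le> ennreal (diameter A powr s)"
proof -
  \<comment> \<open>Padding with empty sets is free: their diameter is 0, and
    \<open>0 powr s\<close> is 0.\<close>
  let ?C = "\<lambda>i::nat. if i = 0 then A else {}"
  have "hausdorff_content s A \<le> (\<Sum>i. ennreal (diameter (?C i) powr s))"
    unfolding hausdorff_content_def
    by (rule INF_lower) (use assms in \<open>auto split: if_splits\<close>)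
  also have "\<dots> = (\<Sum>i\<in>{0}. ennreal (diameter (?C i) powr s))"
    by (rule suminf_finite) auto
  finally show ?thesis by simp
qed

lemma hausdorff_content_empty [simp]: "hausdorff_content s {} = 0"
  using hausdorff_content_le_diameter[of "{}" s] by simp

lemma hausdorff_content_Un:
  "hausdorff_content s (A \<union> B) \<le> hausdorff_content s A + hausdorff_content s B"
proof (rule ennreal_le_epsilon)
  fix e :: real
  assume e: "0 < e" and fin: "hausdorff_content s A + hausdorff_content s B < top"
  have *: "\<exists>C. (\<forall>i. bounded (C i)) \<and> X \<subseteq> (\<Union>i::nat. C i) \<and>
      (\<Sum>i. ennreal (diameter (C i) powr s)) \<le> hausdorff_content s X + ennreal (e/2)"
    if "hausdorff_content s X < top" for X :: "'a set"
  proof -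
    have "hausdorff_content s X < hausdorff_content s X + ennreal (e/2)"
      using that e by (simp add: ennreal_add_left_cancel_less[of _ 0, simplified] ennreal_zero_less_divide)
    then obtain C where "C \<in> {C. (\<forall>i. bounded (C i)) \<and> X \<subseteq> (\<Union>i::nat. C i)}"
      "(\<Sum>i. ennreal (diameter (C i) powr s)) < hausdorff_content s X + ennreal (e/2)"
      unfolding hausdorff_content_def INF_less_iff by blast
    then show ?thesis by (auto intro: less_imp_le)
  qed
  have fA: "hausdorff_content s A < top" and fB: "hausdorff_content s B < top"
    using fin by (auto simp: less_top[symmetric])
  obtain C where C: "\<And>i. bounded (C i)" "A \<subseteq> (\<Union>i::nat. C i)"
    "(\<Sum>i. ennreal (diameter (C i) powr s)) \<le> hausdorff_content s A + ennreal (e/2)"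
    using *[OF fA] by blast
  obtain D where D: "\<And>i. bounded (D i)" "B \<subseteq> (\<Union>i::nat. D i)"
    "(\<Sum>i. ennreal (diameter (D i) powr s)) \<le> hausdorff_content s B + ennreal (e/2)"
    using *[OF fB] by blast
  \<comment> \<open>The two near-optimal covers are interleaved on even and odd indices; summing in
    consecutive pairs later separates their costs again.\<close>
  define G where "G i = (if even i then C (i div 2) else D (i div 2))" for i
  define g where "g i = ennreal (diameter (G i) powr s)" for i
  have "x \<in> (\<Union>i. G i)" if "x \<in> A \<union> B" for x
  proof -
    from that consider i where "x \<in> C i" | i where "x \<in> D i" using C D by blast
    then show ?thesis
    proof cases
      case 1 then have "x \<in> G (2 * i)" by (simp add: G_def)
      then show ?thesis by blast
    next
      case 2 then have "x \<in> G (2 * i + 1)" by (simp add: G_def)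
      then show ?thesis by blast
    qed
  qed
  then have "hausdorff_content s (A \<union> B) \<le> suminf g"
    unfolding hausdorff_content_def g_def using C(1) D(1)
    by (intro INF_lower CollectI conjI subsetI allI) (auto simp: G_def)
  also have "suminf g = (\<Sum>n. \<Sum>i\<in>{n*2..<n*2+2}. g i)"
    using sums_group[OF summable_sums[OF summableI], of 2 g] by (simp add: sums_iff)
  also have "\<dots> = (\<Sum>n. ennreal (diameter (C n) powr s) + ennreal (diameter (D n) powr s))"
  proof -
    have "{n*2..<n*2+2} = {n*2, Suc (n*2)}" for n :: nat by auto
    then show ?thesis by (simp add: g_def G_def)
  qed
  also have "\<dots> = (\<Sum>n. ennreal (diameter (C n) powr s)) + (\<Sum>n. ennreal (diameter (D n) powr s))"
    by (rule suminf_add[symmetric]) auto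
  also have "\<dots> \<le> (hausdorff_content s A + ennreal (e/2)) + (hausdorff_content s B + ennreal (e/2))"
    by (rule add_mono[OF C(3) D(3)])
  also have "\<dots> = hausdorff_content s A + hausdorff_content s B + (ennreal (e/2) + ennreal (e/2))"
    by (simp add: ac_simps)
  also have "ennreal (e/2) + ennreal (e/2) = ennreal e"
    using e by (subst ennreal_plus[symmetric]) auto
  finally show "hausdorff_content s (A \<union> B) \<le> hausdorff_content s A + hausdorff_content s B + ennreal e" .
qed

lemma hausdorff_content_UN:
  assumes "finite I"
  shows "hausdorff_content s (\<Union>i\<in>I. A i) \<le> (\<Sum>i\<in>I. hausdorff_content s (A i))"
  using assms
proof (induction I rule: finite_induct)
  case (insert i I)
  have "hausdorff_content s (\<Union>j\<in>insert i I. A j)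
      \<le> hausdorff_content s (A i) + hausdorff_content s (\<Union>j\<in>I. A j)"
    using hausdorff_content_Un[of s "A i" "\<Union>j\<in>I. A j"] by simp
  then show ?case using insert by (auto intro: order_trans add_left_mono)
qed simp

lemma hausdorff_content_finite: "bounded A \<Longrightarrow> hausdorff_content s A < top"
  using hausdorff_content_le_diameter[of A s] by (auto intro: le_less_trans)

lemma hausdorff_content_nonzero:
  assumes "0 < s" "s < hausdorff_dim A"
  shows "hausdorff_content s A \<noteq> 0"
proof
  assume "hausdorff_content s A = 0"
  moreover have "bdd_below {s::real. s > 0 \<and> hausdorff_content s A = 0}"
    by (rule bdd_belowI[of _ 0]) auto
  ultimately have "hausdorff_dim A \<le> s"
    unfolding hausdorff_dim_def using assms(1) by (intro cInf_lower) auto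
  then show False using assms(2) by simp
qed

text \<open>The code \<open>c n x\<close> is the index of the level-n cell containing x, and the children of cell k are
  the cells N * k + i with i < N.\<close>

lemma frostman_tree:
  fixes E :: "'a::euclidean_space set" and c :: "nat \<Rightarrow> 'a \<Rightarrow> nat"
  assumes E: "compact E" "hausdorff_content s E \<noteq> 0" and s: "s > 0" and N: "N > 0"
    and c0: "\<And>x. x \<in> E \<Longrightarrow> c 0 x = 0"
    and cSuc: "\<And>n x. x \<in> E \<Longrightarrow> c (Suc n) x div N = c n x"
    and cdist: "\<And>n x y. x \<in> E \<Longrightarrow> y \<in> E \<Longrightarrow> c n x = c n y \<Longrightarrow> dist x y \<le> \<delta> n"
    and \<delta>: "\<delta> \<longlonglongrightarrow> 0"
  obtains \<mu> :: "'a measure" where "sets \<mu> = sets borel" "emeasure \<mu> UNIV \<noteq> 0" 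
    "emeasure \<mu> (UNIV - E) = 0"
    "\<And>A n. A \<in> sets borel \<Longrightarrow>
       emeasure \<mu> A \<le> card (c n ` {x\<in>E. \<exists>a\<in>A. dist x a \<le> \<delta> n}) * ennreal (\<delta> n powr s)"
proof -
  have bE: "bounded E" using E(1) compact_imp_bounded by blast
  define h where "h n k = enn2real (hausdorff_content s {x\<in>E. c n x = k})" for n k
  have fin: "hausdorff_content s {x\<in>E. c n x = k} < top" for n k
    using bE by (intro hausdorff_content_finite) (auto intro: bounded_subset)
  have h_enn: "ennreal (h n k) = hausdorff_content s {x\<in>E. c n x = k}" for n k
    using fin[of n k] by (simp add: h_def)
  have h_nonneg: "0 \<le> h n k" for n k by (simp add: h_def)
  have cell_split: "{x\<in>E. c n x = k} = (\<Union>i<N. {x\<in>E. c (Suc n) x = N*k+i})" for n k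
  proof safe
    fix x assume x: "x \<in> E"
    have "c (Suc n) x = N * c n x + c (Suc n) x mod N"
      using cSuc[OF x, of n] by (metis div_mult_mod_eq mult.commute)
    moreover have "c (Suc n) x mod N \<in> {..<N}" using N by simp
    ultimately show "x \<in> (\<Union>i<N. {y \<in> E. c (Suc n) y = N * c n x + i})"
      using x by blast
  next
    fix x i assume "i < N" "x \<in> E" "c (Suc n) x = N * k + i"
    then show "c n x = k" using cSuc[of x n] by simp
  qed
  have h_sub: "h n k \<le> (\<Sum>i<N. h (Suc n) (N*k+i))" for n k
  proof -
    have "ennreal (h n k) \<le> (\<Sum>i<N. hausdorff_content s {x\<in>E. c (Suc n) x = N*k+i})"
      unfolding h_enn cell_split[of n k] by (rule hausdorff_content_UN) simp
    also have "\<dots> = ennreal (\<Sum>i<N. h (Suc n) (N*k+i))"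
      by (simp add: h_enn[symmetric] h_nonneg)
    finally show ?thesis by (subst (asm) ennreal_le_iff) (auto intro: sum_nonneg h_nonneg)
  qed
  have h_ne: "{x\<in>E. c n x = k} \<noteq> {}" if "h n k > 0" for n k
  proof
    assume "{x\<in>E. c n x = k} = {}"
    then show False using that unfolding h_def by (simp only: hausdorff_content_empty) simp
  qed
  have h_le: "h n k \<le> \<delta> n powr s" for n k
  proof (cases "{x\<in>E. c n x = k} = {}")
    case True
    show ?thesis unfolding h_def True by simp
  next
    case False
    have b: "bounded {x\<in>E. c n x = k}" using bE by (auto intro: bounded_subset)
    have "diameter {x\<in>E. c n x = k} \<le> \<delta> n"
      using False by (intro diameter_le) (auto intro: cdist simp: dist_norm[symmetric])
    then have "diameter {x\<in>E. c n x = k} powr s \<le> \<delta> n powr s"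
      using s diameter_ge_0[OF b] by (intro powr_mono2) auto
    moreover have "ennreal (h n k) \<le> ennreal (diameter {x\<in>E. c n x = k} powr s)"
      unfolding h_enn by (rule hausdorff_content_le_diameter[OF b])
    ultimately show ?thesis by simp
  qed
  define M where "M = h 0 0"
  have "{x\<in>E. c 0 x = 0} = E" using c0 by auto
  then have M: "M > 0"
    using E(2) h_enn[of 0 0] h_nonneg[of 0 0] unfolding M_def by (cases "h 0 0 = 0") auto

  \<comment> \<open>Splitting the mass of a cell in proportion to the contents of its children keeps every cell's
    mass below its content, because the content is subadditive.\<close>
  define m where "m = rec_nat (h 0) (\<lambda>n mn k. h (Suc n) k * mn (k div N) / (\<Sum>i<N. h (Suc n) (N * (k div N) + i)))"
  have m0: "m 0 k = h 0 k" for k by (simp add: m_def)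
  have mSuc: "m (Suc n) k = h (Suc n) k * m n (k div N) / (\<Sum>i<N. h (Suc n) (N * (k div N) + i))" for n k
    by (simp add: m_def)
  have m_bd: "0 \<le> m n k \<and> m n k \<le> h n k" for n k
  proof (induction n arbitrary: k)
    case 0 then show ?case by (simp add: m0 h_nonneg)
  next
    case (Suc n)
    let ?S = "\<Sum>i<N. h (Suc n) (N * (k div N) + i)"
    have S: "0 \<le> ?S" by (intro sum_nonneg h_nonneg)
    have "m n (k div N) \<le> ?S" using Suc[of "k div N"] h_sub[of n "k div N"] by linarith
    then have "m (Suc n) k \<le> h (Suc n) k"
      unfolding mSuc using S h_nonneg[of "Suc n" k]
      by (cases "?S = 0") (auto simp: divide_simps intro!: mult_left_mono)
    then show ?case unfolding mSuc using S Suc[of "k div N"] h_nonneg[of "Suc n" k] by auto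
  qed
  have m_sum: "(\<Sum>i<N. m (Suc n) (N*k+i)) = m n k" for n k
  proof -
    let ?S = "\<Sum>i<N. h (Suc n) (N * k + i)"
    have "(\<Sum>i<N. m (Suc n) (N*k+i)) = (\<Sum>i<N. h (Suc n) (N*k+i) * (m n k / ?S))"
      by (rule sum.cong) (auto simp: mSuc)
    also have "\<dots> = ?S * (m n k / ?S)" by (rule sum_distrib_right[symmetric])
    \<comment> \<open>If the contents of the children sum to 0, then \<open>m n k\<close> is
      squeezed between 0 and that sum, so the value 0 given by division by zero is the right
      one.\<close>
    also have "\<dots> = m n k"
      using m_bd[of n k] h_sub[of n k] by (cases "?S = 0") auto
    finally show ?thesis .
  qed
  \<comment> \<open>The measure is the image of Lebesgue measure on {0..<M} under the map sending the nested
    intervals {F n k..<F n (Suc k)} to the level-n cells.\<close>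
  define F where "F n k = (\<Sum>i<k. m n i)" for n k
  have F_refine: "F (Suc n) (N * k) = F n k" for n k
  proof (induction k)
    case 0 then show ?case by (simp add: F_def)
  next
    case (Suc k)
    have "F (Suc n) (N * k + j) = F (Suc n) (N*k) + (\<Sum>i<j. m (Suc n) (N*k+i))" for j
      by (induction j) (auto simp: F_def)
    from this[of N] have "F (Suc n) (N * k + N) = F n k + m n k" using Suc by (simp add: m_sum)
    moreover have "F n (Suc k) = F n k + m n k" by (simp add: F_def)
    moreover have "N * Suc k = N * k + N" by simp
    ultimately show ?case by presburger
  qed
  have F_mono: "F n i \<le> F n j" if "i \<le> j" for n i j
    unfolding F_def using that m_bd by (intro sum_mono2) auto
  have F_top: "F n (N^n) = M" for n
  proof (induction n)
    case 0 then show ?case by (simp add: F_def m0 M_def)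
  next
    case (Suc n) then show ?case using F_refine[of n "N^n"] by simp
  qed
  define idx where "idx n t = (LEAST k. t < F n (Suc k))" for n and t :: real
  have idx_bd: "F n (idx n t) \<le> t \<and> t < F n (Suc (idx n t))" if "t \<in> {0..<M}" for n t
  proof
    have "0 < N^n" using N by simp
    then have "t < F n (Suc (N^n - 1))" using that F_top[of n] by simp
    then show "t < F n (Suc (idx n t))" unfolding idx_def by (rule LeastI)
    show "F n (idx n t) \<le> t"
    proof (cases "idx n t")
      case 0 then show ?thesis using that by (simp add: F_def)
    next
      case (Suc k)
      then have "\<not> t < F n (Suc k)" unfolding idx_def by (metis lessI not_less_Least)
      then show ?thesis using Suc by simp
    qed
  qed
  have uniq: "i = j" if "F n i \<le> t" "t < F n (Suc i)" "F n j \<le> t" "t < F n (Suc j)" for i j n t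
  proof (rule ccontr)
    assume "i \<noteq> j"
    then consider "Suc i \<le> j" | "Suc j \<le> i" by linarith
    then show False using F_mono[of "Suc i" j n] F_mono[of "Suc j" i n] that by cases auto
  qed
  have idx_Suc: "idx (Suc n) t div N = idx n t" if t: "t \<in> {0..<M}" for n t
  proof (rule uniq[of n _ t])
    let ?j = "idx (Suc n) t"
    show "F n (?j div N) \<le> t"
      using F_refine[of n "?j div N"] F_mono[of "N * (?j div N)" ?j "Suc n"]
        idx_bd[OF t, of "Suc n"] times_div_less_eq_dividend[of N ?j] by linarith
    have "?j < N + (?j div N) * N" by (rule dividend_less_div_times[OF N])
    then have "Suc ?j \<le> N * Suc (?j div N)" by (simp add: mult.commute)
    then show "t < F n (Suc (?j div N))"
      using F_refine[of n "Suc (?j div N)"] F_mono[of "Suc ?j" "N * Suc (?j div N)" "Suc n"]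
        idx_bd[OF t, of "Suc n"] by linarith
  qed (use idx_bd[OF t, of n] in auto)
  \<comment> \<open>The half-open interval containing \<open>t\<close> has positive length, so its
    cell has positive content and cannot be empty; this gives \<open>SOME\<close> a witness.\<close>
  define g where "g n k = (SOME x. x \<in> E \<and> c n x = k)" for n k
  have g: "g n (idx n t) \<in> E \<and> c n (g n (idx n t)) = idx n t" if t: "t \<in> {0..<M}" for n t
  proof -
    have "0 < m n (idx n t)" using idx_bd[OF t, of n] by (simp add: F_def)
    then have "0 < h n (idx n t)" using m_bd[of n "idx n t"] by linarith
    from h_ne[OF this] have "\<exists>x. x \<in> E \<and> c n x = idx n t" by blast
    then show ?thesis unfolding g_def by (rule someI_ex)
  qed
  have g_c: "c n (g (n+j) (idx (n+j) t)) = idx n t" if t: "t \<in> {0..<M}" for n j t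
  proof (induction j arbitrary: n)
    case 0 then show ?case using g[OF t] by simp
  next
    case (Suc j)
    have "c n (g (n + Suc j) (idx (n + Suc j) t)) = c (Suc n) (g (Suc n + j) (idx (Suc n + j) t)) div N"
      using cSuc[of "g (n + Suc j) (idx (n + Suc j) t)" n] g[OF t, of "n + Suc j"] by simp
    then show ?case using Suc[of "Suc n"] idx_Suc[OF t] by simp
  qed
  define X where "X n t = g n (idx n t)" for n t
  have X_E: "X n t \<in> E" and X_c: "c n (X n t) = idx n t" if "t \<in> {0..<M}" for n t
    using g[OF that] by (auto simp: X_def)
  have X_dist: "dist (X n t) (X (n+j) t) \<le> \<delta> n" if t: "t \<in> {0..<M}" for n j t
    using X_E[OF t] X_c[OF t] g_c[OF t] by (intro cdist) (auto simp: X_def)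
  have X_cauchy: "Cauchy (\<lambda>n. X n t)" if t: "t \<in> {0..<M}" for t
  proof (rule metric_CauchyI)
    fix e :: real assume "0 < e"
    then have "0 < e/2" by simp
    from order_tendstoD(2)[OF \<delta> this] obtain n where n: "\<delta> n < e/2"
      by (auto simp: eventually_sequentially)
    have "dist (X i t) (X k t) < e" if "i \<ge> n" "k \<ge> n" for i k
      using X_dist[OF t, of n "i - n"] X_dist[OF t, of n "k - n"] that n
        dist_triangle2[of "X i t" "X k t" "X n t"] by (simp add: dist_commute)
    then show "\<exists>n. \<forall>i\<ge>n. \<forall>k\<ge>n. dist (X i t) (X k t) < e" by blast
  qed
  \<comment> \<open>Cells need not be closed, so the limit \<open>f t\<close> may leave the cells of
    \<open>t\<close>. It stays within \<open>\<delta> n\<close> of the point \<open>X n t\<close> of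
    the level-n cell, which is why the final bound counts all cells with a point within
    \<open>\<delta> n\<close> of \<open>A\<close>, not only those that meet
    \<open>A\<close>.\<close>
  define f where "f t = lim (\<lambda>n. X n t)" for t
  have X_lim: "(\<lambda>n. X n t) \<longlonglongrightarrow> f t" if "t \<in> {0..<M}" for t
    using X_cauchy[OF that] unfolding f_def by (simp add: Cauchy_convergent_iff convergent_LIMSEQ_iff)
  have f_E: "f t \<in> E" if t: "t \<in> {0..<M}" for t
    using closed_sequentially[OF compact_imp_closed[OF E(1)] _ X_lim[OF t]] X_E[OF t] by blast
  have f_dist: "dist (X n t) (f t) \<le> \<delta> n" if t: "t \<in> {0..<M}" for n t
  proof (rule LIMSEQ_le_const2)
    show "(\<lambda>k. dist (X n t) (X k t)) \<longlonglongrightarrow> dist (X n t) (f t)"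
      by (intro tendsto_intros X_lim t)
    show "\<exists>N. \<forall>k\<ge>N. dist (X n t) (X k t) \<le> \<delta> n"
      using X_dist[OF t, of n "_ - n"] by (metis le_add_diff_inverse)
  qed
  have [measurable]: "idx n \<in> borel \<rightarrow>\<^sub>M count_space UNIV" for n
    unfolding idx_def by measurable
  \<comment> \<open>\<open>X n\<close> factors through a natural number, so the arbitrary choice
    made in \<open>g\<close> does no harm to measurability.\<close>
  have [measurable]: "(\<lambda>t. X n t) \<in> borel_measurable borel" for n
    unfolding X_def by (rule measurable_compose[of "idx n" _ "count_space UNIV"]) auto
  have f_meas[measurable]: "f \<in> borel_measurable borel"
    unfolding f_def by measurable
  define \<mu> where "\<mu> = distr (restrict_space lborel {0..<M}) borel f"
  have f_meas': "f \<in> restrict_space lborel {0..<M} \<rightarrow>\<^sub>M borel"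
    by (intro measurable_restrict_space1) simp
  have \<mu>: "emeasure \<mu> A = emeasure lborel {t\<in>{0..<M}. f t \<in> A}" if A: "A \<in> sets borel" for A
  proof -
    have "emeasure \<mu> A = emeasure (restrict_space lborel {0..<M}) (f -` A \<inter> {0..<M})"
      unfolding \<mu>_def using A f_meas' by (subst emeasure_distr) (auto simp: space_restrict_space)
    also have "\<dots> = emeasure lborel (f -` A \<inter> {0..<M})"
      by (rule emeasure_restrict_space) auto
    also have "f -` A \<inter> {0..<M} = {t\<in>{0..<M}. f t \<in> A}" by auto
    finally show ?thesis .
  qed
  show thesis
  proof (rule that[of \<mu>])
    show "sets \<mu> = sets borel" by (simp add: \<mu>_def)
    have "{t\<in>{0..<M}. f t \<in> UNIV} = {0..<M}" by auto
    then show "emeasure \<mu> UNIV \<noteq> 0" using M by (simp add: \<mu>)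
    have e: "{t\<in>{0..<M}. f t \<in> UNIV - E} = {}" using f_E by auto
    have "UNIV - E \<in> sets borel" using compact_imp_closed[OF E(1)] by auto
    from \<mu>[OF this] show "emeasure \<mu> (UNIV - E) = 0" unfolding e by simp
    fix A :: "'a set" and n assume A: "A \<in> sets borel"
    define K where "K = c n ` {x\<in>E. \<exists>a\<in>A. dist x a \<le> \<delta> n}"
    have c_bd: "c n x < N^n" if "x \<in> E" for x n
    proof (induction n)
      case 0 then show ?case using c0[OF that] by simp
    next
      case (Suc n)
      then have "c (Suc n) x div N < N^n" using cSuc[OF that] by simp
      then show ?case using N by (simp add: div_less_iff_less_mult mult.commute)
    qed
    have finK: "finite K" by (rule finite_subset[of _ "{..<N^n}"]) (auto simp: K_def c_bd)
    have sub: "{t\<in>{0..<M}. f t \<in> A} \<subseteq> (\<Union>k\<in>K. {F n k..<F n (Suc k)})"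
    proof
      fix t assume "t \<in> {t\<in>{0..<M}. f t \<in> A}"
      then have t: "t \<in> {0..<M}" "f t \<in> A" by auto
      have "idx n t \<in> K" unfolding K_def
        using X_E[OF t(1)] X_c[OF t(1)] f_dist[OF t(1)] t(2) by (intro image_eqI[of _ _ "X n t"]) auto
      then show "t \<in> (\<Union>k\<in>K. {F n k..<F n (Suc k)})" using idx_bd[OF t(1), of n] by auto
    qed
    have "emeasure \<mu> A \<le> emeasure lborel (\<Union>k\<in>K. {F n k..<F n (Suc k)})"
      unfolding \<mu>[OF A] using finK by (intro emeasure_mono sub) auto
    also have "\<dots> \<le> (\<Sum>k\<in>K. emeasure lborel {F n k..<F n (Suc k)})"
      using finK by (intro emeasure_subadditive_finite) auto
    also have "\<dots> \<le> (\<Sum>k\<in>K. ennreal (\<delta> n powr s))"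
    proof (rule sum_mono)
      fix k
      have "m n k \<le> \<delta> n powr s" using m_bd[of n k] h_le[of n k] by linarith
      then show "emeasure lborel {F n k..<F n (Suc k)} \<le> ennreal (\<delta> n powr s)"
        using m_bd[of n k] by (simp add: F_def ennreal_leI)
    qed
    finally show "emeasure \<mu> A \<le> card (c n ` {x\<in>E. \<exists>a\<in>A. dist x a \<le> \<delta> n}) * ennreal (\<delta> n powr s)"
      by (simp add: K_def)
  qed
qed

section \<open>Dyadic cubes and the ball condition\<close>

lemma floor_double_div: "\<lfloor>2 * z\<rfloor> div 2 = \<lfloor>z::real\<rfloor>"
  by linarith

lemma floor_pow_Suc_div: "\<lfloor>2 ^ Suc n * z\<rfloor> div 2 = \<lfloor>2 ^ n * z::real\<rfloor>"
  using floor_double_div[of "2 ^ n * z"] by (simp add: mult.assoc)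

lemma dyadic_scale_exists:
  assumes "0 < u" "u \<le> (1::real)"
  obtains n where "(1/2)^Suc n < u" "u \<le> (1/2)^n"
proof -
  define k where "k = (LEAST k. (1/2::real)^k < u)"
  have k: "(1/2)^k < u" unfolding k_def using real_arch_pow_inv[OF assms(1), of "1/2"] by (auto intro: LeastI_ex)
  with assms obtain n where n: "k = Suc n" by (cases k) auto
  have "\<not> (1/2)^n < u" using not_less_Least[of n "\<lambda>k. (1/2::real)^k < u"] n unfolding k_def by auto
  then show thesis using that[of n] k n by simp
qed

theorem frostman_measure_exists:
  fixes E :: "'a::euclidean_space set"
  assumes E: "compact E" and s: "0 < s" "s < hausdorff_dim E"
  shows "\<exists>\<mu>. frostman s E \<mu>"
proof -
  obtain R0 where R0: "\<And>x. x \<in> E \<Longrightarrow> norm x \<le> R0"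
    using compact_imp_bounded[OF E] unfolding bounded_iff by blast
  \<comment> \<open>The added 1 makes the bound on the coordinates strict, so \<open>y b x\<close>
    is below 1 and all of \<open>E\<close> lies in a single cube at level 0.\<close>
  define R where "R = max R0 0 + 1"
  have R: "R > 0" by (simp add: R_def)
  define d where "d = DIM('a)"
  have d: "d > 0" by (simp add: d_def)
  define y where "y b x = (x \<bullet> b + R) / (2*R)" for x b :: 'a
  define fl where "fl n b x = \<lfloor>2^n * y b x\<rfloor>" for n :: nat and b x :: 'a
  have y01: "0 \<le> y b x \<and> y b x < 1" if "x \<in> E" "b \<in> Basis" for x b
  proof -
    have "\<bar>x \<bullet> b\<bar> < R" using Basis_le_norm[OF that(2), of x] R0[OF that(1)] by (simp add: R_def)
    then show ?thesis using R by (auto simp: y_def divide_simps)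
  qed
  have fl0: "fl 0 b x = 0" if "x \<in> E" "b \<in> Basis" for x b
    using y01[OF that] by (simp add: fl_def floor_eq_iff)
  have fl_div: "fl (Suc n) b x div 2 = fl n b x" for n b x
    unfolding fl_def by (rule floor_pow_Suc_div)
  have fl_eqI: "fl (Suc n) b x = fl (Suc n) b z \<longleftrightarrow> fl n b x = fl n b z \<and> odd (fl (Suc n) b x) = odd (fl (Suc n) b z)" for n b x z
    using fl_div[of n b x] fl_div[of n b z] by presburger
  \<comment> \<open>Halving a cube adds one bit per coordinate, the parity of the new floor. The
    parity pattern, numbered by \<open>\<beta>\<close>, is the last base-\<open>N\<close> digit of
    the code, hence \<open>N\<close> is 2 to the power \<open>d\<close>.\<close>
  define D where "D n x = {b\<in>(Basis::'a set). odd (fl n b x)}" for n x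
  define N where "N = (2::nat)^d"
  have N: "N > 0" by (simp add: N_def)
  have "finite (Pow (Basis::'a set))" by simp
  then obtain \<beta> :: "'a set \<Rightarrow> nat" where \<beta>: "bij_betw \<beta> (Pow Basis) {0..<card (Pow (Basis::'a set))}"
    using ex_bij_betw_finite_nat by blast
  have \<beta>_lt: "\<beta> (D n x) < N" for n x
    using bij_betwE[OF \<beta>] by (auto simp: card_Pow D_def N_def d_def)
  have \<beta>_eq: "\<beta> (D n x) = \<beta> (D n z) \<longleftrightarrow> D n x = D n z" for n x z
    using bij_betw_imp_inj_on[OF \<beta>] by (auto simp: inj_on_eq_iff D_def)
  define c where "c n x = rec_nat 0 (\<lambda>n k. N * k + \<beta> (D (Suc n) x)) n" for n x
  have c0: "c 0 x = 0" and cS: "c (Suc n) x = N * c n x + \<beta> (D (Suc n) x)" for n x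
    by (simp_all add: c_def)
  have c_div: "c (Suc n) x div N = c n x" for n x
    unfolding cS using N \<beta>_lt by simp
  have c_mod: "c (Suc n) x mod N = \<beta> (D (Suc n) x)" for n x
    unfolding cS using \<beta>_lt by simp
  have c_eq: "c n x = c n z \<longleftrightarrow> (\<forall>b\<in>Basis. fl n b x = fl n b z)" if "x \<in> E" "z \<in> E" for n x z
  proof (induction n)
    case 0 then show ?case using that by (simp add: c0 fl0)
  next
    case (Suc n)
    have "c (Suc n) x = c (Suc n) z \<longleftrightarrow> c n x = c n z \<and> \<beta> (D (Suc n) x) = \<beta> (D (Suc n) z)"
      using c_div c_mod cS by metis
    also have "\<dots> \<longleftrightarrow> (\<forall>b\<in>Basis. fl n b x = fl n b z) \<and> (\<forall>b\<in>Basis. odd (fl (Suc n) b x) = odd (fl (Suc n) b z))"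
      unfolding Suc \<beta>_eq by (auto simp: D_def set_eq_iff)
    finally show ?case using fl_eqI by blast
  qed
  \<comment> \<open>A level-n cube has side \<open>2 * R * (1/2)^n\<close>; the factor
    \<open>d\<close> comes from estimating the norm by the sum of the coordinates.\<close>
  define \<delta> where "\<delta> n = 2 * R * d * (1/2)^n" for n :: nat
  have \<delta>_lim: "\<delta> \<longlonglongrightarrow> 0"
    unfolding \<delta>_def by (intro tendsto_mult_right_zero LIMSEQ_power_zero) auto
  have scale: "2^n * y b x - 2^n * y b z = 2^n / (2*R) * (x \<bullet> b - z \<bullet> b)" for n :: nat and b x z
    using R by (simp add: y_def field_simps)
  have c_dist: "dist x z \<le> \<delta> n" if xz: "x \<in> E" "z \<in> E" "c n x = c n z" for n x z
  proof -
    have "\<bar>(x - z) \<bullet> b\<bar> \<le> 2 * R * (1/2)^n" if b: "b \<in> Basis" for b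
    proof -
      have "fl n b x = fl n b z" using c_eq[OF xz(1,2)] xz(3) b by blast
      then have "\<bar>2^n * y b x - 2^n * y b z\<bar> < 1" unfolding fl_def by linarith
      then have "2^n / (2*R) * \<bar>x \<bullet> b - z \<bullet> b\<bar> < 1"
        unfolding scale using R by (simp add: abs_mult)
      then show ?thesis using R by (simp add: inner_diff_left field_simps)
    qed
    then have "(\<Sum>b\<in>Basis. \<bar>(x - z) \<bullet> b\<bar>) \<le> (\<Sum>b\<in>(Basis::'a set). 2 * R * (1/2)^n)"
      by (intro sum_mono)
    also have "\<dots> = \<delta> n" by (simp add: \<delta>_def d_def)
    finally show ?thesis using norm_le_l1[of "x - z"] by (simp add: dist_norm)
  qed
  obtain \<mu> :: "'a measure" where \<mu>: "sets \<mu> = sets borel" "emeasure \<mu> UNIV \<noteq> 0" 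
    "emeasure \<mu> (UNIV - E) = 0"
    and bd: "\<And>A n. A \<in> sets borel \<Longrightarrow>
       emeasure \<mu> A \<le> card (c n ` {x\<in>E. \<exists>a\<in>A. dist x a \<le> \<delta> n}) * ennreal (\<delta> n powr s)"
    by (rule frostman_tree[of E s N c \<delta>])
       (use E hausdorff_content_nonzero[OF s] s N c0 c_div c_dist \<delta>_lim in auto)
  have sp: "space \<mu> = UNIV" using sets_eq_imp_space_eq[OF \<mu>(1)] by simp
  \<comment> \<open>Level 0 has only one cell. This bounds the total mass, giving finiteness of the
    measure and the ball condition for radii above \<open>2 * R\<close>.\<close>
  have "emeasure \<mu> UNIV \<le> card (c 0 ` {x\<in>E. \<exists>a\<in>UNIV. dist x a \<le> \<delta> 0}) * ennreal (\<delta> 0 powr s)"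
    by (rule bd) simp
  also have "\<dots> \<le> 1 * ennreal (\<delta> 0 powr s)"
  proof (rule mult_right_mono)
    have "card (c 0 ` {x\<in>E. \<exists>a\<in>UNIV. dist x a \<le> \<delta> 0}) \<le> card {0::nat}"
      by (rule card_mono) (auto simp: c0)
    then have "card (c 0 ` {x\<in>E. \<exists>a\<in>UNIV. dist x a \<le> \<delta> 0}) \<le> 1" by simp
    from of_nat_mono[OF this] show "of_nat (card (c 0 ` {x\<in>E. \<exists>a\<in>UNIV. dist x a \<le> \<delta> 0})) \<le> (1::ennreal)"
      by (simp only: of_nat_1)
  qed simp
  finally have tot: "emeasure \<mu> UNIV \<le> ennreal (\<delta> 0 powr s)" by simp
  \<comment> \<open>A point counted below is within \<open>\<delta> n + r\<close> of the centre,
    that is, \<open>d + 1\<close> sides of a level-n cube. Its floors then differ from those of the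
    centre by at most \<open>d + 2\<close>, leaving \<open>2 * d + 5\<close> values per
    coordinate.\<close>
  define K where "K = (2 * d + 6)^d"
  have count: "card (c n ` {x\<in>E. \<exists>a\<in>ball z r. dist x a \<le> \<delta> n}) \<le> K"
    if r: "r \<le> 2 * R * (1/2)^n" for n z r
  proof -
    let ?S = "{x\<in>E. \<exists>a\<in>ball z r. dist x a \<le> \<delta> n}"
    let ?fl = "\<lambda>x. \<lambda>b\<in>Basis. fl n b x"
    let ?I = "\<lambda>b. {fl n b z - int d - 2..fl n b z + int d + 2}"
    have sub: "?fl ` ?S \<subseteq> PiE Basis ?I"
    proof (intro image_subsetI restrict_PiE_iff[THEN iffD2] ballI)
      fix x b assume "x \<in> ?S" and b: "b \<in> (Basis::'a set)"
      then obtain a where x: "x \<in> E" "a \<in> ball z r" "dist x a \<le> \<delta> n" by blast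
      have "dist x z \<le> \<delta> n + r" using x dist_triangle[of x z a] by (simp add: dist_commute)
      then have "\<bar>x \<bullet> b - z \<bullet> b\<bar> \<le> \<delta> n + r"
        using Basis_le_norm[OF b, of "x - z"] by (simp add: dist_norm inner_diff_left)
      also have "\<dots> \<le> 2 * R * (1/2)^n * (d + 1)" using r by (simp add: \<delta>_def algebra_simps)
      finally have "2^n / (2*R) * \<bar>x \<bullet> b - z \<bullet> b\<bar> \<le> d + 1"
        using R by (simp add: field_simps)
      then have "\<bar>2^n * y b x - 2^n * y b z\<bar> \<le> d + 1"
        unfolding scale using R by (simp add: abs_mult)
      then show "fl n b x \<in> ?I b" unfolding fl_def atLeastAtMost_iff by linarith
    qed
    have finP: "finite (PiE (Basis::'a set) ?I)" by (intro finite_PiE) auto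
    \<comment> \<open>On \<open>E\<close> the code depends only on the vector of floors, so there
      are at most as many codes as floor vectors.\<close>
    have inv: "c n x = c n (inv_into ?S ?fl (?fl x))" if x: "x \<in> ?S" for x
    proof -
      have i: "inv_into ?S ?fl (?fl x) \<in> ?S" "?fl (inv_into ?S ?fl (?fl x)) = ?fl x"
        using inv_into_into[OF imageI[OF x, of ?fl]] f_inv_into_f[OF imageI[OF x, of ?fl]] by simp_all
      have "fl n b x = fl n b (inv_into ?S ?fl (?fl x))" if "b \<in> Basis" for b
        using fun_cong[OF i(2), of b] that by simp
      then show ?thesis using c_eq[of x "inv_into ?S ?fl (?fl x)" n] x i(1) by blast
    qed
    have "c n ` ?S \<subseteq> (\<lambda>\<phi>. c n (inv_into ?S ?fl \<phi>)) ` (?fl ` ?S)"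
      using inv by blast
    then have "card (c n ` ?S) \<le> card (?fl ` ?S)"
      by (rule surj_card_le[rotated]) (rule finite_subset[OF sub finP])
    also have "\<dots> \<le> card (PiE (Basis::'a set) ?I)" by (rule card_mono[OF finP sub])
    also have "\<dots> = (2 * d + 5)^d"
    proof -
      have "card (?I b) = 2 * d + 5" for b by simp
      then show ?thesis by (simp add: card_PiE d_def del: card_atLeastAtMost_int)
    qed
    also have "\<dots> \<le> K" unfolding K_def by (rule power_mono) auto
    finally show ?thesis .
  qed
  \<comment> \<open>For \<open>r\<close> at most \<open>2 * R\<close>, the level \<open>n\<close> is
    chosen with \<open>2 * R * (1/2)^n\<close> between \<open>r\<close> and \<open>2 * r\<close>.
    Then \<open>\<delta> n\<close> is at most \<open>2 * d * r\<close>, and at most \<open>K\<close>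
    cells contribute.\<close>
  define C where "C = K * (2 * real d) powr s"
  have K1: "1 \<le> real K" by (simp add: K_def)
  have "emeasure \<mu> (ball x r) \<le> ennreal (C * r powr s)" if r: "r > 0" for x r
  proof (cases "r \<le> 2 * R")
    case True
    then have "0 < r / (2*R)" "r / (2*R) \<le> 1" using r R by auto
    from dyadic_scale_exists[OF this] obtain n where n: "(1/2)^Suc n < r / (2*R)" "r / (2*R) \<le> (1/2)^n" .
    have r1: "r \<le> 2 * R * (1/2)^n" using n(2) R by (simp add: field_simps)
    have r2: "\<delta> n \<le> 2 * d * r" using n(1) R d by (simp add: \<delta>_def field_simps)
    have "\<delta> n powr s \<le> (2 * d * r) powr s" using r2 s R by (intro powr_mono2) (auto simp: \<delta>_def)
    then have p: "\<delta> n powr s \<le> (2 * d) powr s * r powr s" using r by (simp add: powr_mult)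
    have "emeasure \<mu> (ball x r) \<le> card (c n ` {z\<in>E. \<exists>a\<in>ball x r. dist z a \<le> \<delta> n}) * ennreal (\<delta> n powr s)"
      by (rule bd) simp
    also have "\<dots> \<le> of_nat K * ennreal ((2 * d) powr s * r powr s)"
      using count[OF r1, of x] p by (intro mult_mono ennreal_leI) auto
    also have "\<dots> = ennreal (C * r powr s)"
      by (simp add: C_def ennreal_mult ennreal_of_nat_eq_real_of_nat mult.assoc)
    finally show ?thesis .
  next
    case False
    have "\<delta> 0 \<le> 2 * d * r" using False d R by (simp add: \<delta>_def field_simps)
    then have "\<delta> 0 powr s \<le> (2 * d * r) powr s" using s R by (intro powr_mono2) (auto simp: \<delta>_def)
    also have "\<dots> = 1 * ((2 * d) powr s * r powr s)" using r by (simp add: powr_mult)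
    also have "\<dots> \<le> K * ((2 * d) powr s * r powr s)" using K1 by (intro mult_right_mono) auto
    finally have "\<delta> 0 powr s \<le> C * r powr s" by (simp add: C_def mult.assoc)
    moreover have "emeasure \<mu> (ball x r) \<le> emeasure \<mu> UNIV" by (rule emeasure_mono) (auto simp: \<mu>)
    ultimately show ?thesis using tot by (meson ennreal_leI order_trans)
  qed
  moreover have "emeasure \<mu> (space \<mu>) < \<infinity>" using tot by (auto simp: sp intro: le_less_trans)
  ultimately show ?thesis unfolding frostman_def using \<mu> sp by (auto intro!: exI[of _ \<mu>] exI[of _ C])
qed

section \<open>Support and separated pieces of a Frostman measure\<close>

lemma frostman_singleton_null:
  assumes "frostman s E \<mu>" "0 < s"
  shows "emeasure \<mu> {x} = 0"
proof -
  obtain C where C: "\<And>x r. r > 0 \<Longrightarrow> emeasure \<mu> (ball x r) \<le> ennreal (C * r powr s)"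
    and sets: "sets \<mu> = sets borel"
    using assms(1) unfolding frostman_def by blast
  have "(\<lambda>n. C * (inverse (real (Suc n))) powr s) \<longlonglongrightarrow> C * 0"
    by (intro tendsto_mult tendsto_const tendsto_zero_powrI[OF LIMSEQ_inverse_real_of_nat _ _ assms(2)])
       auto
  then have "(\<lambda>n. ennreal (C * (inverse (real (Suc n))) powr s)) \<longlonglongrightarrow> ennreal 0"
    by (intro tendsto_ennrealI) simp
  moreover have "emeasure \<mu> {x} \<le> ennreal (C * (inverse (real (Suc n))) powr s)" for n
  proof -
    have "emeasure \<mu> {x} \<le> emeasure \<mu> (ball x (inverse (real (Suc n))))"
      by (rule emeasure_mono) (auto simp: sets)
    also have "\<dots> \<le> ennreal (C * (inverse (real (Suc n))) powr s)" by (rule C) simp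
    finally show ?thesis .
  qed
  ultimately have "emeasure \<mu> {x} \<le> ennreal 0" by (intro LIMSEQ_le_const) auto
  then show ?thesis by simp
qed

text \<open>The complement of the support is the union of all balls of measure zero, and by
  Lindelof's theorem countably many of them already cover it.\<close>

lemma emeasure_support_compl:
  fixes \<mu> :: "'a::euclidean_space measure"
  assumes sets: "sets \<mu> = sets borel"
  shows "- {x. \<forall>r>0. emeasure \<mu> (ball x r) > 0} \<in> null_sets \<mu>"
proof -
  define F where "F = {ball x r | x r. r > 0 \<and> emeasure \<mu> (ball x r) = 0}"
  obtain F' where F': "F' \<subseteq> F" "countable F'" "\<Union>F' = \<Union>F"
    using Lindelof[of F] unfolding F_def by blast
  have "\<Union>F' \<in> null_sets \<mu>"
  proof -
    have "N \<in> null_sets \<mu>" if "N \<in> F'" for N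
      using F'(1) that unfolding F_def by (auto simp: sets null_sets_def)
    then have "(\<Union>N\<in>F'. N) \<in> null_sets \<mu>" by (intro null_sets_UN' F'(2))
    then show ?thesis by simp
  qed
  moreover have "\<Union>F = - {x. \<forall>r>0. emeasure \<mu> (ball x r) > 0}"
  proof (intro equalityI subsetI)
    fix x assume "x \<in> \<Union>F"
    then obtain z r where zr: "r > 0" "emeasure \<mu> (ball z r) = 0" "x \<in> ball z r" unfolding F_def by blast
    have "ball x (r - dist z x) \<subseteq> ball z r"
    proof
      fix w assume "w \<in> ball x (r - dist z x)"
      then show "w \<in> ball z r" using dist_triangle[of z w x] by simp
    qed
    then have "emeasure \<mu> (ball x (r - dist z x)) \<le> emeasure \<mu> (ball z r)"
      by (rule emeasure_mono) (simp add: sets)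
    then have "\<not> emeasure \<mu> (ball x (r - dist z x)) > 0" using zr(2) by simp
    moreover have "r - dist z x > 0" using zr(3) by simp
    ultimately show "x \<in> - {x. \<forall>r>0. emeasure \<mu> (ball x r) > 0}" by blast
  next
    fix x assume "x \<in> - {x. \<forall>r>0. emeasure \<mu> (ball x r) > 0}"
    then obtain r where r: "r > 0" "emeasure \<mu> (ball x r) = 0" by auto
    then have "ball x r \<in> F" unfolding F_def by blast
    then show "x \<in> \<Union>F" using r(1) by (meson UnionI centre_in_ball)
  qed
  ultimately show ?thesis using F'(3) by simp
qed

text \<open>The support is infinite: finite sets are null because there are no atoms, and the
  complement of the support is null as well. Small closed balls around \<open>l\<close> support
  points, cut down to \<open>E\<close>, are the pieces.\<close>

lemma frostman_separated_pieces:
  fixes E :: "'a::euclidean_space set"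
  assumes fr: "frostman s E \<mu>" and s: "0 < s" and E: "compact E"
  obtains Es :: "nat \<Rightarrow> 'a set" where "\<And>i. compact (Es i)" "\<And>i. Es i \<subseteq> E"
    "\<And>i. i < l \<Longrightarrow> emeasure \<mu> (Es i) > 0"
    "\<And>i j. i < l \<Longrightarrow> j < l \<Longrightarrow> i \<noteq> j \<Longrightarrow> \<exists>\<delta>>0. \<forall>a\<in>Es i. \<forall>b\<in>Es j. dist a b \<ge> \<delta>"
proof -
  have sets: "sets \<mu> = sets borel" and pos: "emeasure \<mu> (space \<mu>) \<noteq> 0" and out: "emeasure \<mu> (UNIV - E) = 0"
    using fr unfolding frostman_def by auto
  have sp: "space \<mu> = UNIV" using sets_eq_imp_space_eq[OF sets] by simp
  define S where "S = {x. \<forall>r>0. emeasure \<mu> (ball x r) > 0}"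
  have "infinite S"
  proof
    assume fin: "finite S"
    have "(\<Union>x\<in>S. {x}) \<in> null_sets \<mu>"
      using fin frostman_singleton_null[OF fr s]
      by (intro null_sets_UN' countable_finite) (auto simp: null_sets_def sets)
    then have "(\<Union>x\<in>S. {x}) \<union> - S \<in> null_sets \<mu>"
      using emeasure_support_compl[OF sets] unfolding S_def by (intro null_sets.Un)
    moreover have "(\<Union>x\<in>S. {x}) \<union> - S = UNIV" by auto
    ultimately show False using pos sp by auto
  qed
  then obtain T where T: "T \<subseteq> S" "finite T" "card T = l"
    using infinite_arbitrarily_large by blast
  then obtain g where g: "bij_betw g {0..<l} T" using ex_bij_betw_nat_finite by blast
  \<comment> \<open>The 1 keeps the minimum defined when there are fewer than two points.\<close>
  define Q where "Q = insert 1 ((\<lambda>(a,b). dist a b) ` {(a,b)\<in>T\<times>T. a \<noteq> b})"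
  have "finite {(a,b)\<in>T\<times>T. a \<noteq> b}" using T(2) by (rule_tac finite_subset[of _ "T \<times> T"]) auto
  then have finQ: "finite Q" unfolding Q_def by blast
  define d where "d = Min Q"
  have d: "d > 0" unfolding d_def using finQ by (subst Min_gr_iff) (auto simp: Q_def)
  have dmin: "d \<le> dist (g i) (g j)" if "i < l" "j < l" "i \<noteq> j" for i j
  proof -
    have "g i \<noteq> g j" using g that by (auto simp: bij_betw_def inj_on_eq_iff)
    moreover have "g i \<in> T" "g j \<in> T" using bij_betwE[OF g] that by auto
    ultimately have "dist (g i) (g j) \<in> Q" unfolding Q_def by force
    then show ?thesis unfolding d_def using finQ by simp
  qed
  \<comment> \<open>With centres at least \<open>d\<close> apart, radius \<open>d/3\<close> leaves a
    gap of \<open>d/3\<close> between any two pieces.\<close>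
  define Es where "Es i = cball (g i) (d/3) \<inter> E" for i
  show thesis
  proof
    show "compact (Es i)" "Es i \<subseteq> E" for i
      unfolding Es_def using E by (auto intro: compact_Int)
    show "emeasure \<mu> (Es i) > 0" if "i < l" for i
    proof -
      have "g i \<in> S" using bij_betwE[OF g] that T(1) by auto
      then have "0 < emeasure \<mu> (ball (g i) (d/3))" using d unfolding S_def by auto
      also have "\<dots> \<le> emeasure \<mu> (Es i \<union> (UNIV - E))"
        using E by (intro emeasure_mono) (auto simp: Es_def sets compact_imp_closed)
      also have "\<dots> \<le> emeasure \<mu> (Es i) + emeasure \<mu> (UNIV - E)"
        using E by (intro emeasure_subadditive) (auto simp: Es_def sets compact_imp_closed)
      finally show ?thesis using out by simp
    qed
    fix i j assume ij: "i < l" "j < l" "i \<noteq> j"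
    have "d/3 \<le> dist a b" if "a \<in> Es i" "b \<in> Es j" for a b
    proof -
      have "dist (g i) a \<le> d/3" "dist (g j) b \<le> d/3" using that by (auto simp: Es_def)
      moreover have "dist (g i) (g j) \<le> dist (g i) a + dist a b + dist (g j) b"
        using dist_triangle[of "g i" "g j" a] dist_triangle[of a "g j" b] by (simp add: dist_commute)
      ultimately show ?thesis using dmin[OF ij] by linarith
    qed
    then show "\<exists>\<delta>>0. \<forall>a\<in>Es i. \<forall>b\<in>Es j. dist a b \<ge> \<delta>" using d by (intro exI[of _ "d/3"]) auto
  qed
qed

subsection \<open>Finite product measures\<close>

text \<open>Tychonoff's theorem, over an index type that may be infinite.\<close>

lemma compact_fun_cylinder:
  fixes A :: "'i \<Rightarrow> 'b::topological_space set"
  assumes "\<And>i. compact (A i)"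
  shows "compact {y. \<forall>i. y i \<in> A i}"
proof -
  have "{y. \<forall>i. y i \<in> A i} = PiE UNIV A" by auto
  moreover have "compactin (product_topology (\<lambda>i. euclidean) UNIV) (PiE UNIV A)"
    unfolding compactin_PiE using assms by auto
  ultimately show ?thesis unfolding euclidean_product_topology by simp
qed

text \<open>Among extensional functions the complement of \<open>S\<close> is the union of the boxes
  that miss \<open>S\<close> and have sides from a countable basis; finiteness of \<open>I\<close>
  makes these countably many. The topology lives on all functions, but off \<open>I\<close> every
  point involved has the value \<open>undefined\<close>, so only the coordinates in \<open>I\<close>
  matter.\<close>

lemma closed_fun_sets_PiM:
  fixes S :: "('i \<Rightarrow> real) set"
  assumes I: "finite I" and S: "closed S" "S \<subseteq> PiE I (\<lambda>_. UNIV)"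
  shows "S \<in> sets (Pi\<^sub>M I (\<lambda>_. lborel))"
proof -
  obtain B :: "real set set" where B: "countable B" "topological_basis B"
    using ex_countable_basis by blast
  define Bx where "Bx = {PiE I b | b. b \<in> PiE I (\<lambda>_. B) \<and> PiE I b \<inter> S = {}}"
  have "countable (PiE I (\<lambda>_. B))" using I B(1) by (intro countable_PiE) auto
  then have "countable ((\<lambda>b. PiE I b) ` PiE I (\<lambda>_. B))" by (rule countable_image)
  then have cB: "countable Bx" by (rule countable_subset[rotated]) (auto simp: Bx_def)
  have Bx_sets: "b \<in> sets (Pi\<^sub>M I (\<lambda>_. lborel))" if "b \<in> Bx" for b
  proof -
    from that obtain a where a: "a \<in> PiE I (\<lambda>_. B)" "b = PiE I a" unfolding Bx_def by blast
    have "a i \<in> sets lborel" if "i \<in> I" for i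
      using topological_basis_open[OF B(2) PiE_mem[OF a(1) that]] by simp
    then show ?thesis unfolding a(2) using I by (intro sets_PiM_I_finite)
  qed
  have "PiE I (\<lambda>_. UNIV) - S = \<Union>Bx"
  proof (intro equalityI subsetI)
    fix z assume z: "z \<in> PiE I (\<lambda>_. UNIV) - S"
    have "openin (product_topology (\<lambda>i. euclidean) UNIV) (- S)"
      using S(1) by (simp add: open_fun_def[symmetric] open_Compl)
    from product_topology_open_contains_basis[OF this, of z] z
    obtain X where X: "z \<in> PiE UNIV X" "\<And>i. open (X i)" "PiE UNIV X \<subseteq> - S" by auto
    have "\<forall>i\<in>I. \<exists>b. b \<in> B \<and> z i \<in> b \<and> b \<subseteq> X i"
      using X(1,2) topological_basisE[OF B(2)] by (metis PiE_mem UNIV_I)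
    then obtain b where b: "\<And>i. i \<in> I \<Longrightarrow> b i \<in> B \<and> z i \<in> b i \<and> b i \<subseteq> X i" by metis
    have eq: "PiE I (restrict b I) = PiE I b" by (rule PiE_cong) simp
    have "PiE I b \<subseteq> PiE UNIV X"
    proof (intro subsetI PiE_I)
      fix w i assume w: "w \<in> PiE I b"
      show "w i \<in> X i"
      proof (cases "i \<in> I")
        case True then show ?thesis using PiE_mem[OF w True] b[OF True] by (meson subsetD)
      next
        case False
        have "z \<in> PiE I (\<lambda>_. UNIV)" using z by blast
        then have "w i = z i" using PiE_arb[OF w False] PiE_arb[of z I _ i] False by metis
        then show ?thesis using PiE_mem[OF X(1), of i] by simp
      qed
    qed simp
    then have "PiE I (restrict b I) \<inter> S = {}" unfolding eq using X(3) by blast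
    moreover have "restrict b I \<in> PiE I (\<lambda>_. B)" using b by simp
    ultimately have "PiE I (restrict b I) \<in> Bx" unfolding Bx_def by blast
    moreover have "z \<in> PiE I b"
    proof (rule PiE_I)
      show "z i \<in> b i" if "i \<in> I" for i using b[OF that] by blast
      show "z i = undefined" if "i \<notin> I" for i using z PiE_arb[OF _ that] by blast
    qed
    then have "z \<in> PiE I (restrict b I)" unfolding eq .
    ultimately show "z \<in> \<Union>Bx" by blast
  next
    fix z assume "z \<in> \<Union>Bx"
    then show "z \<in> PiE I (\<lambda>_. UNIV) - S" unfolding Bx_def by (auto simp: PiE_iff)
  qed
  moreover have "\<Union>Bx \<in> sets (Pi\<^sub>M I (\<lambda>_. lborel))"
    using cB Bx_sets by (rule sets.countable_Union[OF _ subsetI])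
  moreover have "S = space (Pi\<^sub>M I (\<lambda>_. lborel)) - (PiE I (\<lambda>_. UNIV) - S)"
    using S(2) by (auto simp: space_PiM)
  ultimately show ?thesis using sets.compl_sets by metis
qed

lemma compact_fun_sets_PiM:
  fixes S :: "('i \<Rightarrow> real) set"
  assumes "finite I" "compact S" "S \<subseteq> PiE I (\<lambda>_. UNIV)"
  shows "S \<in> sets (Pi\<^sub>M I (\<lambda>_. lborel))"
proof (rule closed_fun_sets_PiM)
  have "Hausdorff_space (euclidean :: ('i \<Rightarrow> real) topology)"
    unfolding euclidean_product_topology[symmetric] by (simp add: Hausdorff_space_product_topology)
  then have "closedin euclidean S"
    by (rule compactin_imp_closedin) (use assms(2) in simp)
  then show "closed S" by simp
qed (use assms in auto)

section \<open>Null sets of product measures under merging, restriction and relabelling\<close>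

context product_sigma_finite
begin

lemma AE_PiM_merge:
  assumes "I \<inter> J = {}" "finite I" "finite J" "AE z in Pi\<^sub>M (I \<union> J) M. Q z"
  shows "AE x in Pi\<^sub>M I M. AE y in Pi\<^sub>M J M. Q (merge I J (x, y))"
proof -
  interpret I: finite_product_sigma_finite M I by standard fact
  interpret J: finite_product_sigma_finite M J by standard fact
  interpret P: pair_sigma_finite "Pi\<^sub>M I M" "Pi\<^sub>M J M" by standard
  have "AE z in distr (Pi\<^sub>M I M \<Otimes>\<^sub>M Pi\<^sub>M J M) (Pi\<^sub>M (I \<union> J) M) (merge I J). Q z"
    using assms(4) unfolding distr_merge[OF assms(1-3)] .
  then have "AE p in Pi\<^sub>M I M \<Otimes>\<^sub>M Pi\<^sub>M J M. Q (merge I J p)"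
    by (rule AE_distrD[rotated]) simp
  from P.AE_pair[OF this] show ?thesis .
qed

text \<open>This lifts suitability, which concerns only the neighbours of a vertex, to all
  previously revealed points. The factors need not have mass 1, so restriction need not preserve
  measure; but the preimage of a null set \<open>N\<close> is a cylinder over \<open>N\<close>, and
  such a cylinder is null.\<close>

lemma AE_PiM_restrict:
  assumes "I \<subseteq> J" "finite J" "AE x in Pi\<^sub>M I M. Q x"
  shows "AE x in Pi\<^sub>M J M. Q (restrict x I)"
proof -
  define K where "K = J - I"
  have J: "J = I \<union> K" "I \<inter> K = {}" "finite I" "finite K"
    using assms(1,2) by (auto simp: K_def intro: finite_subset)
  interpret I: finite_product_sigma_finite M I by standard fact
  interpret K: finite_product_sigma_finite M K by standard fact
  from assms(3) obtain N where N: "{x \<in> space (Pi\<^sub>M I M). \<not> Q x} \<subseteq> N" "emeasure (Pi\<^sub>M I M) N = 0" "N \<in> sets (Pi\<^sub>M I M)"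
    by (rule AE_E)
  have meas: "(\<lambda>x. restrict x I) \<in> Pi\<^sub>M J M \<rightarrow>\<^sub>M Pi\<^sub>M I M"
    by (rule measurable_restrict_subset[OF assms(1)])
  define N' where "N' = (\<lambda>x. restrict x I) -` N \<inter> space (Pi\<^sub>M J M)"
  have N': "N' \<in> sets (Pi\<^sub>M J M)" unfolding N'_def by (rule measurable_sets[OF meas N(3)])
  have "merge I K -` N' \<inter> space (Pi\<^sub>M I M \<Otimes>\<^sub>M Pi\<^sub>M K M) = N \<times> space (Pi\<^sub>M K M)"
  proof -
    have "merge I K p \<in> N' \<longleftrightarrow> fst p \<in> N" if p: "p \<in> space (Pi\<^sub>M I M \<Otimes>\<^sub>M Pi\<^sub>M K M)" for p
    proof -
      obtain x y where xy: "p = (x, y)" "x \<in> space (Pi\<^sub>M I M)" "y \<in> space (Pi\<^sub>M K M)"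
        using p by (auto simp: space_pair_measure)
      have "merge I K p \<in> space (Pi\<^sub>M J M)"
        using measurable_space[OF measurable_merge p] J(1) by simp
      moreover have "restrict (merge I K p) I = x"
        using xy J(2) by (simp add: space_PiM PiE_iff extensional_restrict)
      ultimately show ?thesis using xy by (simp add: N'_def)
    qed
    then show ?thesis using sets.sets_into_space[OF N(3)]
      by (auto simp: space_pair_measure)
  qed
  then have "emeasure (Pi\<^sub>M J M) N' = emeasure (Pi\<^sub>M I M \<Otimes>\<^sub>M Pi\<^sub>M K M) (N \<times> space (Pi\<^sub>M K M))"
    using N' distr_merge[OF J(2-4)] J(1) by (metis emeasure_distr measurable_merge)
  also have "\<dots> = 0"
    using N by (simp add: K.emeasure_pair_measure_Times)
  finally have "emeasure (Pi\<^sub>M J M) N' = 0" .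
  then have "N' \<in> null_sets (Pi\<^sub>M J M)" using N' by auto
  moreover have "{x \<in> space (Pi\<^sub>M J M). \<not> Q (restrict x I)} \<subseteq> N'"
    using N(1) measurable_space[OF meas] by (auto simp: N'_def)
  ultimately show ?thesis by (rule AE_I')
qed

end

text \<open>Needed because star values are indexed by positions in the construction order, whereas
  edge values are indexed by edges.\<close>

lemma AE_PiM_reindex:
  fixes M :: "'b measure" and g :: "'i \<Rightarrow> 'j"
  assumes M: "sigma_finite_measure M" and g: "bij_betw g I J" and fin: "finite I"
    and Q: "AE x in Pi\<^sub>M I (\<lambda>_. M). Q x"
  shows "AE x in Pi\<^sub>M J (\<lambda>_. M). Q (\<lambda>i\<in>I. x (g i))"
proof -
  interpret I: product_sigma_finite "\<lambda>_::'i. M" using M by (simp add: product_sigma_finite_def)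
  interpret J: product_sigma_finite "\<lambda>_::'j. M" using M by (simp add: product_sigma_finite_def)
  have finJ: "finite J" using g fin bij_betw_finite by blast
  have gJ: "g i \<in> J" if "i \<in> I" for i using g that bij_betwE by blast
  have meas: "(\<lambda>x. \<lambda>i\<in>I. x (g i)) \<in> Pi\<^sub>M J (\<lambda>_. M) \<rightarrow>\<^sub>M Pi\<^sub>M I (\<lambda>_. M)"
    by (intro measurable_restrict measurable_component_singleton gJ)
  have eq: "distr (Pi\<^sub>M J (\<lambda>_. M)) (Pi\<^sub>M I (\<lambda>_. M)) (\<lambda>x. \<lambda>i\<in>I. x (g i)) = Pi\<^sub>M I (\<lambda>_. M)"
  proof (rule I.PiM_eqI[OF fin])
    fix A :: "'i \<Rightarrow> 'b set" assume A: "\<And>i. i \<in> I \<Longrightarrow> A i \<in> sets M"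
    let ?h = "inv_into I g"
    have h: "?h j \<in> I" "g (?h j) = j" if "j \<in> J" for j
      using g that by (auto simp: bij_betw_def inv_into_into f_inv_into_f)
    have hg: "?h (g i) = i" if "i \<in> I" for i using g that by (simp add: bij_betw_inv_into_left)
    have "(\<lambda>x. \<lambda>i\<in>I. x (g i)) -` PiE I A \<inter> space (Pi\<^sub>M J (\<lambda>_. M)) = PiE J (\<lambda>j. A (?h j))"
    proof (intro equalityI subsetI)
      fix x assume x: "x \<in> (\<lambda>x. \<lambda>i\<in>I. x (g i)) -` PiE I A \<inter> space (Pi\<^sub>M J (\<lambda>_. M))"
      have "x j \<in> A (?h j)" if "j \<in> J" for j
      proof -
        have "(\<lambda>i\<in>I. x (g i)) (?h j) \<in> A (?h j)" using x h[OF that] by (blast intro: PiE_mem)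
        then show ?thesis using h[OF that] by simp
      qed
      then show "x \<in> PiE J (\<lambda>j. A (?h j))" using x by (auto simp: space_PiM PiE_iff)
    next
      fix x assume x: "x \<in> PiE J (\<lambda>j. A (?h j))"
      have "x \<in> space (Pi\<^sub>M J (\<lambda>_. M))"
        using x A h(1) sets.sets_into_space by (fastforce simp: space_PiM PiE_iff)
      moreover have "x (g i) \<in> A i" if "i \<in> I" for i
        using PiE_mem[OF x gJ[OF that]] hg[OF that] by simp
      ultimately show "x \<in> (\<lambda>x. \<lambda>i\<in>I. x (g i)) -` PiE I A \<inter> space (Pi\<^sub>M J (\<lambda>_. M))"
        by auto
    qed
    then have "emeasure (distr (Pi\<^sub>M J (\<lambda>_. M)) (Pi\<^sub>M I (\<lambda>_. M)) (\<lambda>x. \<lambda>i\<in>I. x (g i))) (PiE I A)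
        = emeasure (Pi\<^sub>M J (\<lambda>_. M)) (PiE J (\<lambda>j. A (?h j)))"
      using A fin by (subst emeasure_distr[OF meas]) (auto intro!: sets_PiM_I_finite)
    also have "\<dots> = (\<Prod>j\<in>J. emeasure M (A (?h j)))"
      using A h(1) by (intro J.emeasure_PiM finJ) auto
    also have "\<dots> = (\<Prod>i\<in>I. emeasure M (A i))"
      using hg by (simp add: prod.reindex_bij_betw[OF g, symmetric])
    finally show "emeasure (distr (Pi\<^sub>M J (\<lambda>_. M)) (Pi\<^sub>M I (\<lambda>_. M)) (\<lambda>x. \<lambda>i\<in>I. x (g i))) (PiE I A)
        = (\<Prod>i\<in>I. emeasure M (A i))" .
  qed simp
  show ?thesis using Q by (intro AE_distrD[OF meas]) (simp only: eq)
qed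

section \<open>Restricted measures and absolute continuity\<close>

lemma restr_measure_simps [simp]:
  "sets (restr_measure \<mu> F) = sets \<mu>" "space (restr_measure \<mu> F) = space \<mu>"
  by (simp_all add: restr_measure_def)

lemma emeasure_restr_measure:
  assumes "F \<in> sets \<mu>" "A \<in> sets \<mu>"
  shows "emeasure (restr_measure \<mu> F) A = emeasure \<mu> (A \<inter> F)"
proof -
  have "emeasure (restr_measure \<mu> F) A = (\<integral>\<^sup>+x. indicator F x * indicator A x \<partial>\<mu>)"
    unfolding restr_measure_def using assms by (subst emeasure_density) auto
  also have "\<dots> = (\<integral>\<^sup>+x. indicator (A \<inter> F) x \<partial>\<mu>)"
    by (rule nn_integral_cong) (auto split: split_indicator)
  finally show ?thesis using assms by simp
qed

lemma AE_restr_measure_mem: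
  assumes "F \<in> sets \<mu>"
  shows "AE x in restr_measure \<mu> F. x \<in> F"
  unfolding restr_measure_def using assms by (subst AE_density) (auto simp: indicator_def)

lemma Lp_density_AE:
  assumes "Lp_density M p N" "AE x in M. Q x"
  shows "AE x in N. Q x"
proof -
  obtain f :: "'a \<Rightarrow> real" where f: "f \<in> borel_measurable M" "N = density M (\<lambda>z. ennreal (f z))"
    using assms(1) unfolding Lp_density_def by blast
  show ?thesis unfolding f(2) using f(1) assms(2) by (subst AE_density) auto
qed

subsection \<open>Configurations\<close>

lemma finite_measure_restr_measure:
  assumes "emeasure \<mu> (space \<mu>) < \<infinity>" "F \<in> sets \<mu>"
  shows "finite_measure (restr_measure \<mu> F)"
proof
  have "emeasure (restr_measure \<mu> F) (space \<mu>) \<le> emeasure \<mu> (space \<mu>)"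
    using assms(2) by (simp add: emeasure_restr_measure emeasure_space)
  then show "emeasure (restr_measure \<mu> F) (space (restr_measure \<mu> F)) \<noteq> \<infinity>"
    using assms(1) by auto
qed

section \<open>Edge values and measurability of the pinned configuration set\<close>

lemma edge_ends:
  assumes "e = {u, w}" "u \<noteq> w"
  shows "(end1 e = u \<and> end2 e = w) \<or> (end1 e = w \<and> end2 e = u)"
proof -
  have "end1 e \<in> e" unfolding end1_def by (rule someI[of _ u]) (simp add: assms)
  moreover have "\<exists>x. x \<in> e \<and> x \<noteq> end1 e" using assms by (metis insertCI)
  then have "end2 e \<in> e \<and> end2 e \<noteq> end1 e" unfolding end2_def by (rule someI_ex)
  ultimately show ?thesis using assms by auto
qed

text \<open>\<open>end1\<close> and \<open>end2\<close> orient an edge arbitrarily; symmetry of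
  \<open>\<Phi>\<close> makes the orientation irrelevant.\<close>

lemma Phi_edge_ends:
  assumes "edge_vector_function Ed \<Phi>" "e \<in> Ed" "e = {u, w}" "u \<noteq> w"
  shows "\<Phi> e (y (end1 e)) (y (end2 e)) = \<Phi> e (y u) (y w)"
  using edge_ends[OF assms(3,4)] assms(1,2) unfolding edge_vector_function_def by metis

lemma simple_graph_finite_edges:
  assumes "simple_graph V Ed"
  shows "finite Ed"
proof (rule finite_subset)
  show "Ed \<subseteq> Pow V" using assms unfolding simple_graph_def by auto
  show "finite (Pow V)" using assms unfolding simple_graph_def by simp
qed

lemma continuous_on_Phi_eval:
  assumes "edge_vector_function Ed \<Phi>" "R \<subseteq> Ed"
  shows "continuous_on UNIV (Phi_eval R \<Phi>)"
proof (rule continuous_on_coordinatewise_then_product)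
  fix e
  show "continuous_on UNIV (\<lambda>y. Phi_eval R \<Phi> y e)"
  proof (cases "e \<in> R")
    case True
    then have c: "continuous_on UNIV (\<lambda>(a,b). \<Phi> e a b)"
      using assms unfolding edge_vector_function_def by blast
    have "continuous_on UNIV (\<lambda>y::'a \<Rightarrow> 'b. (y (end1 e), y (end2 e)))"
      by (intro continuous_intros continuous_on_product_coordinates)
    from continuous_on_compose2[OF c this] show ?thesis
      using True by (simp add: Phi_eval_def)
  qed (simp add: Phi_eval_def)
qed

lemma Phi_eval_image_sets:
  assumes "edge_vector_function Ed \<Phi>" "finite Ed" "R \<subseteq> Ed" "compact K"
  shows "Phi_eval R \<Phi> ` K \<in> sets (Pi\<^sub>M R (\<lambda>_. lborel))"
proof (rule compact_fun_sets_PiM)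
  show "finite R" using assms(2,3) by (rule rev_finite_subset)
  show "compact (Phi_eval R \<Phi> ` K)"
    using continuous_on_subset[OF continuous_on_Phi_eval[OF assms(1,3)]] assms(4)
    by (intro compact_continuous_image) auto
  show "Phi_eval R \<Phi> ` K \<subseteq> PiE R (\<lambda>_. UNIV)" by (auto simp: Phi_eval_def)
qed

text \<open>Distinctness is not a closed condition, but it is the union over \<open>n\<close> of the
  closed conditions that free points are at least \<open>1/(n+1)\<close> apart. Each of these gives
  a compact set of configurations with a compact image.\<close>

lemma pinned_config_set_sets:
  fixes E :: "'a::euclidean_space set"
  assumes "simple_graph V Ed" "edge_vector_function Ed \<Phi>" "compact E"
  shows "pinned_config_set V Ed P \<Phi> x E \<in> sets (Pi\<^sub>M Ed (\<lambda>_. lborel))"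
proof -
  define A where "A v = (if v \<in> P then {x v} else if v \<in> V then E else {undefined})" for v
  define K where "K n = {y. \<forall>v. y v \<in> A v} \<inter>
    (\<Inter>v\<in>V-P. \<Inter>w\<in>V-P-{v}. {y. inverse (real (Suc n)) \<le> dist (y v) (y w)})" for n
  have "compact (K n)" for n
  proof -
    have "compact {y. \<forall>v. y v \<in> A v}"
      using assms(3) by (intro compact_fun_cylinder) (auto simp: A_def)
    moreover have "closed {y :: 'v \<Rightarrow> 'a. inverse (real (Suc n)) \<le> dist (y v) (y w)}" for v w
      by (intro closed_Collect_le continuous_intros continuous_on_product_coordinates)
    ultimately show ?thesis unfolding K_def by (intro compact_Int_closed closed_INT ballI)
  qed
  then have "(\<Union>n. Phi_eval Ed \<Phi> ` K n) \<in> sets (Pi\<^sub>M Ed (\<lambda>_. lborel))"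
    using Phi_eval_image_sets[OF assms(2) simple_graph_finite_edges[OF assms(1)]] by blast
  moreover have "(\<Union>n. Phi_eval Ed \<Phi> ` K n) = pinned_config_set V Ed P \<Phi> x E"
  proof (intro equalityI subsetI)
    fix z assume "z \<in> (\<Union>n. Phi_eval Ed \<Phi> ` K n)"
    then obtain n y where y: "y \<in> K n" "z = Phi_eval Ed \<Phi> y" by auto
    have "y v \<noteq> y w" if "v \<in> V - P" "w \<in> V - P" "v \<noteq> w" for v w
    proof -
      have "inverse (real (Suc n)) \<le> dist (y v) (y w)" using y(1) that unfolding K_def by blast
      moreover have "0 < inverse (real (Suc n))" by simp
      ultimately show ?thesis by (metis dist_self not_le)
    qed
    then have "inj_on y (V - P)" by (intro inj_onI) blast
    moreover have yA: "y v \<in> A v" for v using y(1) unfolding K_def by blast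
    have "(\<forall>v\<in>P. y v = x v) \<and> (\<forall>v\<in>V - P. y v \<in> E)"
      using yA unfolding A_def by (metis DiffD1 DiffD2 singletonD)
    ultimately show "z \<in> pinned_config_set V Ed P \<Phi> x E"
      unfolding pinned_config_set_def y(2) by blast
  next
    fix z assume "z \<in> pinned_config_set V Ed P \<Phi> x E"
    then obtain y where y: "z = Phi_eval Ed \<Phi> y" "\<forall>v\<in>P. y v = x v" "\<forall>v\<in>V - P. y v \<in> E" "inj_on y (V - P)"
      unfolding pinned_config_set_def by blast
    \<comment> \<open>Configurations are unconstrained off the graph. Resetting them to
      \<open>undefined\<close> there places them in a product of compact sets and leaves every edge
      value unchanged.\<close>
    define y' where "y' v = (if v \<in> V \<union> P then y v else undefined)" for v
    have ends: "end1 e \<in> V \<and> end2 e \<in> V" if "e \<in> Ed" for e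
    proof -
      from assms(1) that obtain u w where uw: "u \<in> V" "w \<in> V" "u \<noteq> w" "e = {u, w}"
        unfolding simple_graph_def by blast
      from edge_ends[OF uw(4,3)] uw show ?thesis by auto
    qed
    have z': "z = Phi_eval Ed \<Phi> y'"
      unfolding y(1) Phi_eval_def by (intro restrict_ext) (simp add: y'_def ends)
    have finV: "finite (V - P)" using assms(1) unfolding simple_graph_def by simp
    define Q where "Q = insert 1 ((\<lambda>(v,w). dist (y v) (y w)) ` {(v,w)\<in>(V-P)\<times>(V-P). v \<noteq> w})"
    have "finite {(v,w)\<in>(V-P)\<times>(V-P). v \<noteq> w}"
      by (rule finite_subset[of _ "(V-P)\<times>(V-P)"]) (use finV in auto)
    then have finQ: "finite Q" unfolding Q_def by blast
    have "0 < Min Q" using finQ y(4) by (subst Min_gr_iff) (auto simp: Q_def inj_on_def)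
    then obtain n where n: "inverse (real (Suc n)) < Min Q" using reals_Archimedean by blast
    have "inverse (real (Suc n)) \<le> dist (y' v) (y' w)" if "v \<in> V - P" "w \<in> V - P - {v}" for v w
    proof -
      have "dist (y v) (y w) \<in> Q" using that unfolding Q_def by force
      then have "Min Q \<le> dist (y v) (y w)" using finQ by simp
      then show ?thesis using n that by (simp add: y'_def)
    qed
    moreover have "y' v \<in> A v" for v using y by (auto simp: A_def y'_def)
    ultimately have "y' \<in> K n" unfolding K_def by blast
    then show "z \<in> (\<Union>n. Phi_eval Ed \<Phi> ` K n)" unfolding z' by blast
  qed
  ultimately show ?thesis by simp
qed

section \<open>Backward induction along the construction order\<close>

text \<open>The edges whose values are not yet determined by the first \<open>r\<close>
  points.\<close>

definition later_edges :: "'v set set \<Rightarrow> 'v list \<Rightarrow> nat \<Rightarrow> 'v set set" where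
  "later_edges Ed vs r = {e\<in>Ed. \<exists>k. r \<le> k \<and> k < length vs \<and> vs ! k \<in> e}"

text \<open>The value \<open>undefined\<close> off the list makes this a product of compact sets
  once the pieces are compact. Distinctness is left out: it will follow from disjointness of the
  pieces.\<close>

definition tail_configs :: "'v list \<Rightarrow> nat \<Rightarrow> (nat \<Rightarrow> 'a set) \<Rightarrow> (nat \<Rightarrow> 'a) \<Rightarrow> ('v \<Rightarrow> 'a) set" where
  "tail_configs vs r Es x =
     {y. (\<forall>i<length vs. y (vs ! i) \<in> (if i < r then {x i} else Es i)) \<and> (\<forall>v. v \<notin> set vs \<longrightarrow> y v = undefined)}"

lemma compact_tail_configs:
  assumes "distinct vs" "\<And>i. compact (Es i)"
  shows "compact (tail_configs vs r Es x)"
proof -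
  define A where "A v = (if v \<in> set vs then let i = (THE i. i < length vs \<and> vs ! i = v) in
      (if i < r then {x i} else Es i) else {undefined})" for v
  have A_nth: "A (vs ! i) = (if i < r then {x i} else Es i)" if "i < length vs" for i
  proof -
    have "(THE j. j < length vs \<and> vs ! j = vs ! i) = i"
      using assms(1) that by (intro the_equality) (auto simp: nth_eq_iff_index_eq)
    then show ?thesis using that by (simp add: A_def)
  qed
  have "tail_configs vs r Es x = {y. \<forall>v. y v \<in> A v}"
  proof (intro equalityI subsetI CollectI allI)
    fix y v assume y: "y \<in> tail_configs vs r Es x"
    show "y v \<in> A v"
    proof (cases "v \<in> set vs")
      case True
      then obtain i where "i < length vs" "v = vs ! i" by (metis in_set_conv_nth)
      then show ?thesis using y A_nth unfolding tail_configs_def by auto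
    next
      case False then show ?thesis using y by (simp add: A_def tail_configs_def)
    qed
  next
    fix y assume y: "y \<in> {y. \<forall>v. y v \<in> A v}"
    then have "y (vs ! i) \<in> (if i < r then {x i} else Es i)" if "i < length vs" for i
      using A_nth[OF that] by blast
    moreover have "y v = undefined" if "v \<notin> set vs" for v
    proof -
      have "y v \<in> A v" using y by blast
      then show ?thesis using that by (simp add: A_def)
    qed
    ultimately show "y \<in> tail_configs vs r Es x" unfolding tail_configs_def by blast
  qed
  moreover have "compact {y. \<forall>v. y v \<in> A v}"
    by (rule compact_fun_cylinder) (auto simp: A_def Let_def assms(2))
  ultimately show ?thesis by simp
qed

lemma borel_measurable_star_map:
  assumes "edge_vector_function Ed \<Phi>"
  shows "star_map Ed \<Phi> vs r x \<in> borel \<rightarrow>\<^sub>M Pi\<^sub>M (eta Ed vs r) (\<lambda>_. lborel)"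
proof -
  have "(\<lambda>y. \<Phi> {vs ! i, vs ! r} (x i) y) \<in> borel \<rightarrow>\<^sub>M borel" if "i \<in> eta Ed vs r" for i
  proof -
    have c: "continuous_on UNIV (\<lambda>(a,b). \<Phi> {vs ! i, vs ! r} a b)"
      using assms that unfolding edge_vector_function_def eta_def by blast
    have "continuous_on UNIV (\<lambda>y. (x i, y))" by (intro continuous_intros)
    from continuous_on_compose2[OF c this] show ?thesis
      by (intro borel_measurable_continuous_onI) simp
  qed
  then show ?thesis unfolding star_map_def by (intro measurable_restrict) simp
qed

text \<open>Each step meets two exceptional sets of earlier points: those whose star at
  \<open>r\<close> has no density, and those for which the induction hypothesis fails for a non-null
  set of r-th points. Both are null in the product of the first \<open>r\<close> measures, so the
  claim has to be made almost everywhere in all these points jointly.\<close>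

lemma AE_tail_configs_positive:
  fixes \<Phi> :: "'v set \<Rightarrow> 'a::euclidean_space \<Rightarrow> 'a \<Rightarrow> real"
  assumes G: "simple_graph (set vs) Ed" and \<Phi>: "edge_vector_function Ed \<Phi>" and vs: "distinct vs"
    and \<mu>: "sets \<mu> = sets borel" "emeasure \<mu> UNIV < \<infinity>"
    and Es: "\<And>i. compact (Es i)" "\<And>i. i < length vs \<Longrightarrow> emeasure \<mu> (Es i) > 0"
    and star: "\<And>r. m \<le> r \<Longrightarrow> r < length vs \<Longrightarrow>
      AE x in Pi\<^sub>M (eta Ed vs r) (\<lambda>i. restr_measure \<mu> (Es i)).
        Lp_density (Pi\<^sub>M (eta Ed vs r) (\<lambda>_. lborel)) p
          (distr (restr_measure \<mu> (Es r)) (Pi\<^sub>M (eta Ed vs r) (\<lambda>_. lborel)) (star_map Ed \<Phi> vs r x))"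
    and m: "m \<le> length vs"
  shows "AE x in Pi\<^sub>M {..<m} (\<lambda>i. restr_measure \<mu> (Es i)).
    emeasure (Pi\<^sub>M (later_edges Ed vs m) (\<lambda>_. lborel))
      (Phi_eval (later_edges Ed vs m) \<Phi> ` tail_configs vs m Es x) > 0"
  using m star
proof (induction rule: inc_induct)
  case base
  let ?R = "later_edges Ed vs (length vs)"
  have R: "?R = {}" by (auto simp: later_edges_def)
  show ?case
  proof (rule AE_I2)
    fix x :: "nat \<Rightarrow> 'a"
    \<comment> \<open>With no edge left, the value set is the only point of the empty product, of
      mass 1, as soon as some configuration exists; \<open>y\<close> is one.\<close>
    define y where "y v = (if v \<in> set vs then x (THE i. i < length vs \<and> vs ! i = v) else undefined)" for v
    have "(THE j. j < length vs \<and> vs ! j = vs ! i) = i" if "i < length vs" for i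
      using vs that by (intro the_equality) (auto simp: nth_eq_iff_index_eq)
    then have "y \<in> tail_configs vs (length vs) Es x"
      by (auto simp: tail_configs_def y_def)
    moreover have "Phi_eval ?R \<Phi> z = (\<lambda>_. undefined)" for z
      by (simp add: Phi_eval_def R fun_eq_iff)
    ultimately have "Phi_eval ?R \<Phi> ` tail_configs vs (length vs) Es x = {\<lambda>_. undefined}"
      by (auto simp: image_constant)
    then show "emeasure (Pi\<^sub>M ?R (\<lambda>_. lborel)) (Phi_eval ?R \<Phi> ` tail_configs vs (length vs) Es x) > 0"
      unfolding R by (simp add: PiM_empty)
  qed
next
  case (step r)
  let ?M = "\<lambda>i. restr_measure \<mu> (Es i)"
  let ?L = "\<lambda>_::'v set. lborel :: real measure"
  let ?\<eta> = "eta Ed vs r"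
  have sp: "space \<mu> = UNIV" using sets_eq_imp_space_eq[OF \<mu>(1)] by simp
  have Es_sets: "Es i \<in> sets \<mu>" for i using borel_compact[OF Es(1)[of i]] by (simp add: \<mu>(1))
  have tot: "emeasure (?M i) UNIV = emeasure \<mu> (Es i)" for i
    using Es_sets by (subst emeasure_restr_measure) (auto simp: \<mu>(1))
  have "finite_measure (?M i)" for i
    by (rule finite_measure_restr_measure) (use \<mu>(2) Es_sets sp in auto)
  then interpret M: product_sigma_finite ?M
    by (simp add: product_sigma_finite_def finite_measure.axioms(1))
  interpret L: product_sigma_finite ?L by standard
  define R where "R = later_edges Ed vs (Suc r)"
  define R0 where "R0 = later_edges Ed vs r"
  \<comment> \<open>\<open>S\<close> collects the edges from the r-th vertex back to earlier ones.
    Its edges to later vertices already belong to \<open>R\<close>, so \<open>R0\<close> is the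
    disjoint union of \<open>S\<close> and \<open>R\<close>.\<close>
  define g where "g i = {vs ! i, vs ! r}" for i
  define S where "S = g ` ?\<eta>"
  define h where "h = inv_into ?\<eta> g"
  have finEd: "finite Ed" using simple_graph_finite_edges[OF G] .
  have R_sub: "R \<subseteq> Ed" "R0 \<subseteq> Ed" unfolding R_def R0_def later_edges_def by auto
  have r: "r < length vs" using step by simp
  have neq: "vs ! i \<noteq> vs ! r" if "i < r" for i using vs r that by (simp add: nth_eq_iff_index_eq)
  have inj_g: "inj_on g ?\<eta>"
  proof (rule inj_onI)
    fix i j assume ij: "i \<in> ?\<eta>" "j \<in> ?\<eta>" "g i = g j"
    then have "vs ! i = vs ! j" using neq unfolding g_def eta_def by (auto simp: doubleton_eq_iff)
    then show "i = j" using vs r ij by (simp add: nth_eq_iff_index_eq eta_def)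
  qed
  have h: "h e \<in> ?\<eta>" "g (h e) = e" if "e \<in> S" for e
    using that unfolding S_def h_def by (rule inv_into_into, rule f_inv_into_f)
  have bij_h: "bij_betw h S ?\<eta>" unfolding h_def S_def
    by (rule bij_betw_inv_into) (simp add: bij_betw_def inj_g)
  have fin\<eta>: "finite ?\<eta>" unfolding eta_def by simp
  have finS: "finite S" and finR: "finite R"
    unfolding S_def using fin\<eta> R_sub finEd by (auto intro: finite_subset)
  have disj: "S \<inter> R = {}"
  proof -
    have False if i: "i < r" "vs ! k = vs ! i \<or> vs ! k = vs ! r" "Suc r \<le> k" "k < length vs" for i k
      using i vs r by (auto simp: nth_eq_iff_index_eq)
    then show ?thesis unfolding S_def R_def g_def eta_def later_edges_def by auto
  qed
  have union: "S \<union> R = R0"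
  proof (intro equalityI subsetI)
    fix e assume "e \<in> S \<union> R"
    then show "e \<in> R0" using r unfolding S_def R_def R0_def g_def eta_def later_edges_def
      by (auto intro: Suc_leD)
  next
    fix e assume e: "e \<in> R0"
    show "e \<in> S \<union> R"
    proof (cases "e \<in> R")
      case False
      from e obtain k where k: "r \<le> k" "k < length vs" "vs ! k \<in> e" "e \<in> Ed"
        unfolding R0_def later_edges_def by blast
      have kr: "k = r" using False k unfolding R_def later_edges_def by (cases "k = r") auto
      from k(4) obtain u where u: "u \<in> set vs" "u \<noteq> vs ! r" "e = {u, vs ! r}"
        using G k(3) kr unfolding simple_graph_def by (metis insert_commute insert_iff singletonD)
      obtain i where i: "i < length vs" "u = vs ! i" using u(1) by (metis in_set_conv_nth)
      have "\<not> Suc r \<le> i" using False i u(3) k(4) unfolding R_def later_edges_def by auto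
      moreover have "i \<noteq> r" using i u(2) by auto
      ultimately have "i < r" by simp
      then have "i \<in> ?\<eta>" using k(4) u(3) i(2) unfolding eta_def by simp
      then show ?thesis using u(3) i(2) unfolding S_def g_def by blast
    qed simp
  qed
  have IH: "AE x in Pi\<^sub>M {..<Suc r} ?M. emeasure (Pi\<^sub>M R ?L) (Phi_eval R \<Phi> ` tail_configs vs (Suc r) Es x) > 0"
    unfolding R_def by (rule step.IH) (use step.prems in auto)
  have split: "{..<Suc r} = {..<r} \<union> {r}" by auto
  let ?Q = "\<lambda>x. emeasure (Pi\<^sub>M R ?L) (Phi_eval R \<Phi> ` tail_configs vs (Suc r) Es x) > 0"
  have "AE x in Pi\<^sub>M {..<r} ?M. AE y in Pi\<^sub>M {r} ?M. ?Q (merge {..<r} {r} (x, y))"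
  proof (rule M.AE_PiM_merge[of "{..<r}" "{r}" ?Q])
    show "AE x in Pi\<^sub>M ({..<r} \<union> {r}) ?M. ?Q x" using IH unfolding split .
  qed simp_all
  moreover have "AE x in Pi\<^sub>M {..<r} ?M. Lp_density (Pi\<^sub>M ?\<eta> (\<lambda>_. lborel)) p
          (distr (?M r) (Pi\<^sub>M ?\<eta> (\<lambda>_. lborel)) (star_map Ed \<Phi> vs r (restrict x ?\<eta>)))"
    by (rule M.AE_PiM_restrict[OF _ _ step.prems[OF order_refl r]]) (auto simp: eta_def)
  ultimately show ?case
  proof eventually_elim
    case (elim x)
    let ?D = "Phi_eval R0 \<Phi> ` tail_configs vs r Es x"
    let ?D' = "\<lambda>y. Phi_eval R \<Phi> ` tail_configs vs (Suc r) Es (x(r := y))"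
    have "AE y in distr (?M r) (Pi\<^sub>M {r} ?M) (\<lambda>y. \<lambda>i\<in>{r}. y).
        emeasure (Pi\<^sub>M R ?L) (Phi_eval R \<Phi> ` tail_configs vs (Suc r) Es (merge {..<r} {r} (x, y))) > 0"
      unfolding M.distr_component by (rule elim(1))
    then have "AE y in ?M r. emeasure (Pi\<^sub>M R ?L)
        (Phi_eval R \<Phi> ` tail_configs vs (Suc r) Es (merge {..<r} {r} (x, \<lambda>i\<in>{r}. y))) > 0"
      by (rule AE_distrD[rotated]) (auto intro!: measurable_restrict)
    \<comment> \<open>Only the values at indices up to \<open>r\<close> are read, so it does not
      matter that the merged function is \<open>undefined\<close> beyond \<open>r\<close>.\<close>
    moreover have "tail_configs vs (Suc r) Es (merge {..<r} {r} (x, \<lambda>i\<in>{r}. y)) = tail_configs vs (Suc r) Es (x(r := y))" for y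
      unfolding tail_configs_def
      by (intro Collect_cong conj_cong refl all_cong1 imp_cong) (auto simp: merge_def)
    ultimately have posD': "AE y in ?M r. emeasure (Pi\<^sub>M R ?L) (?D' y) > 0" by simp
    have D_sets: "?D \<in> sets (Pi\<^sub>M R0 ?L)"
      by (intro Phi_eval_image_sets[OF \<Phi> finEd] R_sub compact_tail_configs vs Es)
    have D'_sets: "?D' y \<in> sets (Pi\<^sub>M R ?L)" for y
      by (intro Phi_eval_image_sets[OF \<Phi> finEd] R_sub compact_tail_configs vs Es)
    define T where "T y = (\<lambda>e\<in>S. star_map Ed \<Phi> vs r x y (h e))" for y
    \<comment> \<open>A configuration with the r-th point fixed at \<open>y\<close> is also one with
      that point free, provided \<open>y\<close> lies in \<open>Es r\<close>. Its values on
      \<open>S\<close> form \<open>T y\<close>, and those on \<open>R\<close> form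
      \<open>w\<close>.\<close>
    have fibre: "merge S R (T y, w) \<in> ?D" if y: "y \<in> Es r" and w: "w \<in> ?D' y" for y w
    proof -
      obtain Y where Y: "Y \<in> tail_configs vs (Suc r) Es (x(r := y))" "w = Phi_eval R \<Phi> Y"
        using w by auto
      have Y_mem: "Y (vs ! i) \<in> (if i < Suc r then {(x(r := y)) i} else Es i)" if "i < length vs" for i
        using Y(1) that unfolding tail_configs_def by blast
      have Yi: "Y (vs ! i) = x i" if "i < r" for i
        using Y_mem[of i] that r by simp
      have Yr: "Y (vs ! r) = y" using Y_mem[OF r] by simp
      have "Y \<in> tail_configs vs r Es x"
        unfolding tail_configs_def
      proof (intro CollectI conjI allI impI)
        fix i assume i: "i < length vs"
        consider "i < r" | "i = r" | "Suc r \<le> i" by linarith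
        then show "Y (vs ! i) \<in> (if i < r then {x i} else Es i)"
        proof cases
          case 3 then show ?thesis using Y_mem[OF i] by simp
        qed (use Yi Yr y in auto)
      qed (use Y(1) in \<open>auto simp: tail_configs_def\<close>)
      moreover have "merge S R (T y, w) = Phi_eval R0 \<Phi> Y"
      proof
        fix e
        consider "e \<in> S" | "e \<in> R" "e \<notin> S" | "e \<notin> S" "e \<notin> R" by blast
        then show "merge S R (T y, w) e = Phi_eval R0 \<Phi> Y e"
        proof cases
          case 1
          let ?i = "h e"
          have i: "?i \<in> ?\<eta>" "e = {vs ! ?i, vs ! r}" using h[OF 1] by (auto simp: g_def)
          have ir: "?i < r" using i(1) by (simp add: eta_def)
          have "e \<in> R0" using 1 union by blast
          then have "Phi_eval R0 \<Phi> Y e = \<Phi> e (Y (end1 e)) (Y (end2 e))" by (simp add: Phi_eval_def)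
          also have "\<dots> = \<Phi> e (Y (vs ! ?i)) (Y (vs ! r))"
            by (rule Phi_edge_ends[OF \<Phi> _ i(2) neq[OF ir]]) (use \<open>e \<in> R0\<close> R_sub in blast)
          also have "\<dots> = T y e"
            using 1 i by (simp add: T_def star_map_def Yi[OF ir] Yr)
          finally show ?thesis using 1 by (simp add: merge_def)
        next
          case 2
          then have "e \<in> R0" using union by blast
          then show ?thesis using 2 by (simp add: merge_def Y(2) Phi_eval_def)
        next
          case 3
          then have "e \<notin> R0" using union by blast
          then show ?thesis using 3 by (simp add: merge_def Phi_eval_def)
        qed
      qed
      ultimately show ?thesis by blast
    qed
    show "0 < emeasure (Pi\<^sub>M (later_edges Ed vs r) ?L) (Phi_eval (later_edges Ed vs r) \<Phi> ` tail_configs vs r Es x)"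
      unfolding R0_def[symmetric]
    proof (rule ccontr)
      assume "\<not> emeasure (Pi\<^sub>M R0 ?L) ?D > 0"
      then have "?D \<in> null_sets (Pi\<^sub>M R0 ?L)" using D_sets by (auto simp: null_sets_def)
      then have "AE z in Pi\<^sub>M (S \<union> R) ?L. z \<notin> ?D" unfolding union by (rule AE_not_in)
      then have "AE u in Pi\<^sub>M S ?L. AE w in Pi\<^sub>M R ?L. merge S R (u, w) \<notin> ?D"
        by (rule L.AE_PiM_merge[OF disj finS finR])
      \<comment> \<open>Coordinates change from edges to positions, the form in which the law of the
        star map is given.\<close>
      then have "AE u in Pi\<^sub>M ?\<eta> (\<lambda>_. lborel). AE w in Pi\<^sub>M R ?L. merge S R (\<lambda>e\<in>S. u (h e), w) \<notin> ?D"
        by (rule AE_PiM_reindex[OF sigma_finite_lborel bij_h finS])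
      from Lp_density_AE[OF elim(2) this]
      have "AE y in ?M r. AE w in Pi\<^sub>M R ?L.
          merge S R (\<lambda>e\<in>S. star_map Ed \<Phi> vs r (restrict x ?\<eta>) y (h e), w) \<notin> ?D"
        by (rule AE_distrD[rotated])
           (use borel_measurable_star_map[OF \<Phi>] \<mu>(1) in \<open>simp cong: measurable_cong_sets\<close>)
      moreover have "star_map Ed \<Phi> vs r (restrict x ?\<eta>) = star_map Ed \<Phi> vs r x"
        by (auto simp: star_map_def fun_eq_iff)
      ultimately have "AE y in ?M r. AE w in Pi\<^sub>M R ?L. merge S R (T y, w) \<notin> ?D"
        by (simp add: T_def)
      \<comment> \<open>For almost every \<open>y\<close> in \<open>Es r\<close> the null fibre over
        \<open>T y\<close> contains \<open>?D' y\<close>, which has positive measure. So the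
        restricted measure would vanish, against the positive mass of \<open>Es r\<close>.\<close>
      then have "AE y in ?M r. False"
        using posD' AE_restr_measure_mem[OF Es_sets[of r]]
      proof eventually_elim
        case (elim y)
        have "AE w in Pi\<^sub>M R ?L. w \<notin> ?D' y"
          using elim(1) by eventually_elim (use fibre elim(3) in blast)
        then have "?D' y \<in> null_sets (Pi\<^sub>M R ?L)" using AE_iff_null_sets[OF D'_sets] by blast
        then show False using elim(2) by auto
      qed
      then have "emeasure (?M r) (space (?M r)) = 0"
        using AE_iff_null[of "?M r" "\<lambda>_. False"] by (simp add: null_sets_def)
      then show False using Es(2)[OF r] by (simp add: sp tot)
    qed
  qed
qed

section \<open>Choice of the measure, the pieces and the pins\<close>

theorem theoremB:
  fixes V :: "'v set" and Ed :: "'v set set" and P :: "'v set"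
    and \<Phi> :: "'v set \<Rightarrow> 'a::euclidean_space \<Rightarrow> 'a \<Rightarrow> real"
    and \<alpha> :: real and p :: ereal
  assumes "simple_graph V Ed"
    and "P \<subseteq> V"
    and "\<forall>e\<in>Ed. \<not> e \<subseteq> P"
    and "0 < \<alpha>" and "\<alpha> < real DIM('a)"
    and "1 \<le> p"
    and "edge_vector_function Ed \<Phi>"
    and "alpha_suitable_stars \<alpha> p V Ed P \<Phi>"
  shows "\<forall>E::'a set. compact E \<and> hausdorff_dim E > \<alpha> \<longrightarrow>
           (\<exists>x::'v \<Rightarrow> 'a. (\<forall>v\<in>P. x v \<in> E) \<and> inj_on x P \<and>
              pinned_config_set V Ed P \<Phi> x E \<in> sets (Pi\<^sub>M Ed (\<lambda>_. lborel)) \<and>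
              emeasure (Pi\<^sub>M Ed (\<lambda>_. lborel)) (pinned_config_set V Ed P \<Phi> x E) > 0)"
proof (intro allI impI)
  fix E :: "'a set"
  assume E: "compact E \<and> hausdorff_dim E > \<alpha>"
  obtain vs where ord: "construction_order V P vs"
    and suit: "\<And>r E s \<mu> (Es :: nat \<Rightarrow> 'a set). card P \<le> r \<Longrightarrow> r < card V \<Longrightarrow>
            compact E \<and> hausdorff_dim E > \<alpha> \<and> s > \<alpha> \<and> frostman s E \<mu> \<and>
            (\<forall>i\<in>insert r (eta Ed vs r). compact (Es i) \<and> Es i \<subseteq> E \<and> emeasure \<mu> (Es i) > 0) \<and>
            (\<forall>i\<in>insert r (eta Ed vs r). \<forall>j\<in>insert r (eta Ed vs r). i \<noteq> j \<longrightarrow>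
               (\<exists>\<delta>>0. \<forall>a\<in>Es i. \<forall>b\<in>Es j. dist a b \<ge> \<delta>)) \<Longrightarrow>
            (AE xs in Pi\<^sub>M (eta Ed vs r) (\<lambda>i. restr_measure \<mu> (Es i)).
               Lp_density (Pi\<^sub>M (eta Ed vs r) (\<lambda>_. lborel)) p
                 (distr (restr_measure \<mu> (Es r)) (Pi\<^sub>M (eta Ed vs r) (\<lambda>_. lborel))
                    (star_map Ed \<Phi> vs r xs)))"
    using assms(8) unfolding alpha_suitable_stars_def by (elim exE conjE) blast
  define m where "m = card P"
  have vs: "distinct vs" "set vs = V" "set (take m vs) = P"
    using ord unfolding construction_order_def m_def by auto
  have len: "length vs = card V" using vs distinct_card by metis
  have finV: "finite V" using vs(2) by auto
  have m_le: "m \<le> length vs" unfolding m_def len by (rule card_mono[OF finV assms(2)])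
  have nth_P: "vs ! i \<in> P \<longleftrightarrow> i < m" if "i < length vs" for i
    using vs(1,3) that m_le by (auto simp: in_set_conv_nth nth_eq_iff_index_eq simp flip: vs(3))
  \<comment> \<open>Frostman's lemma needs \<open>s\<close> below the dimension and suitability
    needs it above \<alpha>; the midpoint satisfies both.\<close>
  define s where "s = (\<alpha> + hausdorff_dim E) / 2"
  have s: "\<alpha> < s" "0 < s" "s < hausdorff_dim E" using E assms(4) unfolding s_def by auto
  obtain \<mu> where \<mu>: "frostman s E \<mu>"
    using frostman_measure_exists[of E s] E s by blast
  obtain Es :: "nat \<Rightarrow> 'a set" where Es: "\<And>i. compact (Es i)" "\<And>i. Es i \<subseteq> E"
    "\<And>i. i < length vs \<Longrightarrow> emeasure \<mu> (Es i) > 0"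
    "\<And>i j. i < length vs \<Longrightarrow> j < length vs \<Longrightarrow> i \<noteq> j \<Longrightarrow> \<exists>\<delta>>0. \<forall>a\<in>Es i. \<forall>b\<in>Es j. dist a b \<ge> \<delta>"
    using frostman_separated_pieces[OF \<mu> s(2), of "length vs"] E by blast
  have disj: "Es i \<inter> Es j = {}" if ij: "i < length vs" "j < length vs" "i \<noteq> j" for i j
    using Es(4)[OF ij] by fastforce
  have \<mu>_sets: "sets \<mu> = sets borel" using \<mu> unfolding frostman_def by blast
  then have sp: "space \<mu> = UNIV" using sets_eq_imp_space_eq by fastforce
  have \<mu>_fin: "emeasure \<mu> UNIV < \<infinity>" using \<mu> sp unfolding frostman_def by metis
  have star: "AE x in Pi\<^sub>M (eta Ed vs r) (\<lambda>i. restr_measure \<mu> (Es i)).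
      Lp_density (Pi\<^sub>M (eta Ed vs r) (\<lambda>_. lborel)) p
        (distr (restr_measure \<mu> (Es r)) (Pi\<^sub>M (eta Ed vs r) (\<lambda>_. lborel)) (star_map Ed \<Phi> vs r x))"
    if r: "m \<le> r" "r < length vs" for r
  proof (rule suit[of r E s])
    have lt: "i < length vs" if "i \<in> insert r (eta Ed vs r)" for i
      using that r by (auto simp: eta_def)
    show "compact E \<and> hausdorff_dim E > \<alpha> \<and> s > \<alpha> \<and> frostman s E \<mu> \<and>
            (\<forall>i\<in>insert r (eta Ed vs r). compact (Es i) \<and> Es i \<subseteq> E \<and> emeasure \<mu> (Es i) > 0) \<and>
            (\<forall>i\<in>insert r (eta Ed vs r). \<forall>j\<in>insert r (eta Ed vs r). i \<noteq> j \<longrightarrow>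
               (\<exists>\<delta>>0. \<forall>a\<in>Es i. \<forall>b\<in>Es j. dist a b \<ge> \<delta>))"
      using E s(1) \<mu> by (intro conjI ballI impI Es lt) simp_all
  qed (use r len in \<open>simp_all add: m_def\<close>)
  let ?M = "\<lambda>i. restr_measure \<mu> (Es i)"
  let ?D = "\<lambda>x. Phi_eval (later_edges Ed vs m) \<Phi> ` tail_configs vs m Es x"
  have ae: "AE x in Pi\<^sub>M {..<m} ?M. emeasure (Pi\<^sub>M (later_edges Ed vs m) (\<lambda>_. lborel)) (?D x) > 0"
    by (rule AE_tail_configs_positive[OF _ assms(7) vs(1) \<mu>_sets \<mu>_fin Es(1,3) star m_le])
       (simp_all add: vs(2) assms(1))
  have Es_sets: "Es i \<in> sets \<mu>" for i using borel_compact[OF Es(1)[of i]] by (simp add: \<mu>_sets)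
  have M_fin: "finite_measure (?M i)" for i
    by (rule finite_measure_restr_measure) (use \<mu>_fin Es_sets sp in auto)
  interpret M: product_sigma_finite ?M
    using M_fin by (simp add: product_sigma_finite_def finite_measure.axioms(1))
  \<comment> \<open>An almost-everywhere statement alone yields no point. The box of the first
    \<open>m\<close> pieces has positive product measure, so the exceptional null set cannot contain
    it.\<close>
  obtain x where x: "x \<in> PiE {..<m} Es" "emeasure (Pi\<^sub>M (later_edges Ed vs m) (\<lambda>_. lborel)) (?D x) > 0"
  proof (rule ccontr)
    assume none: "\<not> thesis"
    from ae obtain N where N: "{x \<in> space (Pi\<^sub>M {..<m} ?M). \<not> emeasure (Pi\<^sub>M (later_edges Ed vs m) (\<lambda>_. lborel)) (?D x) > 0} \<subseteq> N"
      "emeasure (Pi\<^sub>M {..<m} ?M) N = 0" "N \<in> sets (Pi\<^sub>M {..<m} ?M)"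
      by (rule AE_E)
    have "PiE {..<m} Es \<subseteq> N"
    proof
      fix x assume x: "x \<in> PiE {..<m} Es"
      then have "x \<in> space (Pi\<^sub>M {..<m} ?M)" by (auto simp: space_PiM sp PiE_iff)
      then show "x \<in> N" using N(1) none that x by blast
    qed
    then have "emeasure (Pi\<^sub>M {..<m} ?M) (PiE {..<m} Es) = 0"
      using emeasure_mono[OF _ N(3)] N(2) by (metis le_zero_eq)
    moreover have "emeasure (Pi\<^sub>M {..<m} ?M) (PiE {..<m} Es) = (\<Prod>i<m. emeasure (?M i) (Es i))"
      by (rule M.emeasure_PiM) (use Es_sets in auto)
    ultimately obtain i where i: "i < m" "emeasure (?M i) (Es i) = 0" by (auto simp: prod_zero_iff)
    then show False using Es(3)[of i] m_le Es_sets[of i] by (simp add: emeasure_restr_measure)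
  qed
  define idx where "idx v = (THE i. i < length vs \<and> vs ! i = v)" for v
  have idx: "idx (vs ! i) = i" if "i < length vs" for i
    unfolding idx_def using vs(1) that by (intro the_equality) (auto simp: nth_eq_iff_index_eq)
  define xv where "xv v = x (idx v)" for v
  have P_nth: "\<exists>i<m. v = vs ! i" if v: "v \<in> P" for v
    using v nth_P assms(2) vs(2) by (metis in_set_conv_nth subsetD)
  have x_mem: "x i \<in> Es i" if "i < m" for i using x(1) that by auto
  \<comment> \<open>Used twice, for the pins and for the free vertices: points taken from disjoint
    pieces are distinct.\<close>
  have inj_nth: "inj_on y A" if AV: "A \<subseteq> V"
    and mem: "\<And>i. i < length vs \<Longrightarrow> vs ! i \<in> A \<Longrightarrow> y (vs ! i) \<in> Es i"
    for y :: "'v \<Rightarrow> 'a" and A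
  proof (rule inj_onI)
    fix v w assume vw: "v \<in> A" "w \<in> A" "y v = y w"
    obtain i where i: "i < length vs" "v = vs ! i" using vw(1) AV vs(2) by (metis in_set_conv_nth subsetD)
    obtain j where j: "j < length vs" "w = vs ! j" using vw(2) AV vs(2) by (metis in_set_conv_nth subsetD)
    have "y v \<in> Es i \<inter> Es j" using mem[OF i(1)] mem[OF j(1)] i(2) j(2) vw by simp
    then show "v = w" using disj[OF i(1) j(1)] i(2) j(2) by blast
  qed
  \<comment> \<open>No edge lies within the pins, so every edge has an endpoint at a position from
    \<open>m\<close> on, and the induction accounts for all edges.\<close>
  have edges: "later_edges Ed vs m = Ed"
  proof -
    have "\<exists>k. m \<le> k \<and> k < length vs \<and> vs ! k \<in> e" if e: "e \<in> Ed" for e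
    proof -
      obtain v where v: "v \<in> e" "v \<notin> P" using assms(3) e by blast
      from assms(1) e obtain u w where "u \<in> V" "w \<in> V" "e = {u, w}"
        unfolding simple_graph_def by blast
      then have "v \<in> V" using v(1) by auto
      then obtain k where k: "k < length vs" "v = vs ! k" using vs(2) by (metis in_set_conv_nth)
      then show ?thesis using nth_P[OF k(1)] v by (intro exI[of _ k]) auto
    qed
    then show ?thesis unfolding later_edges_def by auto
  qed
  have meas: "pinned_config_set V Ed P \<Phi> xv E \<in> sets (Pi\<^sub>M Ed (\<lambda>_. lborel))"
    using pinned_config_set_sets[OF assms(1,7)] E by blast
  have sub: "?D x \<subseteq> pinned_config_set V Ed P \<Phi> xv E"
  proof
    fix z assume "z \<in> ?D x"
    then obtain y where y: "z = Phi_eval Ed \<Phi> y" "y \<in> tail_configs vs m Es x" unfolding edges by blast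
    have y_mem: "y (vs ! i) \<in> (if i < m then {x i} else Es i)" if "i < length vs" for i
      using y(2) that unfolding tail_configs_def by blast
    have "y v = xv v" if "v \<in> P" for v
    proof -
      from P_nth[OF that] obtain i where "i < m" "v = vs ! i" by blast
      then show ?thesis using y_mem[of i] idx[of i] m_le by (simp add: xv_def)
    qed
    moreover have tail: "y (vs ! i) \<in> Es i" if "i < length vs" "vs ! i \<in> V - P" for i
      using y_mem[OF that(1)] nth_P[OF that(1)] that(2) by simp
    have "y v \<in> E" if "v \<in> V - P" for v
    proof -
      from that obtain i where "i < length vs" "v = vs ! i" using vs(2) by (metis DiffD1 in_set_conv_nth)
      then show ?thesis using tail[of i] that Es(2)[of i] by blast
    qed
    moreover have "inj_on y (V - P)" by (rule inj_nth) (use tail in auto)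
    ultimately show "z \<in> pinned_config_set V Ed P \<Phi> xv E"
      unfolding pinned_config_set_def using y(1) by blast
  qed
  have xv_mem: "xv (vs ! i) \<in> Es i" if "i < length vs" "vs ! i \<in> P" for i
    using that nth_P[OF that(1)] x_mem idx[OF that(1)] by (simp add: xv_def)
  show "\<exists>x. (\<forall>v\<in>P. x v \<in> E) \<and> inj_on x P \<and>
        pinned_config_set V Ed P \<Phi> x E \<in> sets (Pi\<^sub>M Ed (\<lambda>_. lborel)) \<and>
        emeasure (Pi\<^sub>M Ed (\<lambda>_. lborel)) (pinned_config_set V Ed P \<Phi> x E) > 0"
  proof (intro exI conjI ballI)
    show "xv v \<in> E" if "v \<in> P" for v
    proof -
      from P_nth[OF that] obtain i where "i < m" "v = vs ! i" by blast
      then show ?thesis using xv_mem[of i] that m_le Es(2)[of i] by auto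
    qed
    show "inj_on xv P" by (rule inj_nth[OF assms(2) xv_mem])
    show "emeasure (Pi\<^sub>M Ed (\<lambda>_. lborel)) (pinned_config_set V Ed P \<Phi> xv E) > 0"
      using x(2) emeasure_mono[OF sub meas] unfolding edges by (rule less_le_trans)
  qed (rule meas)
qed

end
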